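(* Suppose the Fokker-Planck operator $\mathcal{L}'$ is in quadratic pre-GENERIC form with entropy the relative entropy $\mathcal{S}_\mu(\rho)=\int_{\mathbb{R}^d}\log\left(\frac{\rho(x)}{\mu(x)}\right)\rho(x)\,dx$, i.e. $$\mathcal{L}'\rho=W\rho-M_\rho\left(\tfrac12\,\mathbf{d}\mathcal{S}_\mu(\rho)\right),\qquad (W(\rho),\mathbf{d}\mathcal{S}_\mu(\rho))=0\quad\text{for all }\rho\in\mathcal{V},$$ where, for each $\rho>0$, $M_\rho$ is symmetric and positive semidefinite with respect to $(\cdot,\cdot)$, and $W$ is an operator on $\mathcal{V}$ such that both $W$ and $W'$ are defined on $\mathcal{V}$ and obey the chain and product rule. Assume that $M_\rho$ has a square root $M_\rho^{1/2}$, i.e. $(M_\rho^{1/2})'M_\rho^{1/2}=M_\rho$, of the form $$M_\rho^{1/2}(\xi)=\sqrt{2\rho}\,A(\xi)$$ for some operator $A$ which does not depend on $\rho$ and which obeys the chain rule. Then the Kolmogorov operator $\mathcal{L}$ can be written in linear hypocoercive form $\mathcal{L}=B-A^*A$, where $B=W'$ is antisymmetric in $L^2_\mu$ and $A$ is related to $M_\rho$ by $M_\rho(\xi)=2A'(\rho A(\xi))$; equivalently, if $\rho_t$ solves $\partial_t\rho_t=\mathcal{L}'\rho_t$, then $h_t=\rho_t/\mu$ solves $\partial_t h_t=-(B+A^*A)h_t$.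
   Context: Setting. $\{X_t\}_{t\ge0}$ is a time-homogeneous Markov process on $\mathbb{R}^d$ with generator (Kolmogorov operator) $\mathcal{L}$. A prime $'$ denotes the formal adjoint in $L^2(\mathbb{R}^d)$, a star $^*$ the adjoint in $L^2_\mu:=\{f:\int f^2\mu\,dx<\infty\}$; $(f,g)=\int_{\mathbb{R}^d} fg\,dx$ denotes the $L^2$ scalar product (acting possibly only as a formal duality pairing). The Fokker-Planck equation is $\partial_t\rho_t=\mathcal{L}'\rho_t$. It is implicitly assumed that $(\mathcal{L}')'=\mathcal{L}$ on $\mathcal{V}$, and similarly for $B$ and $W$. Standing assumptions: (1) all probability measures have a Lebesgue density, denoted by the same letter; (2) $X_t$ admits a unique invariant measure $\mu$, with smooth enough density, $\mu(x)>0$ for all $x$, so that $\mathcal{L}'\mu=0$ and (by ergodicity) the kernel of the linear operator $\mathcal{L}$ in $L^2_\mu$ consists exactly of the constants; (3) the Fokker-Planck equation admits strictly positive classical solutions belonging to $L^2(\mathbb{R}^d)\cap L^1(\mathbb{R}^d)$; (4) $\mathcal{L}$ generates a strongly continuous contraction semigroup on $L^2_\mu$. $\mathcal{D}_2(\cdot)$ denotes the domain in $L^2_\mu$. $\mathcal{V}$ is a fixed set of functions, dense both in $\mathcal{D}_2(\mathcal{L})\cap\mathcal{D}_2(\mathcal{L}^* )$ and in the set of positive classical solutions of the Fokker-Planck equation lying in $L^2\cap L^1$, on which all operators are assumed to act and on which all calculations are performed (in practice $\mathcal{V}$ can often be taken to be the (positive) Schwartz functions). Linear hypocoercive form: $\mathcal{L}$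 is linear and $\mathcal{L}=B-A^*A$, where $A:\mathcal{V}\to(L^2_\mu)^d$ and $B:\mathcal{V}\to L^2_\mu$ are linear, $A=(A_1,\dots,A_d)$ obeys the chain rule, $A^*A:=\sum_i A_i^*A_i$, $B$ is antisymmetric in $L^2_\mu$ ($B^*=-B$) and obeys the chain and product rule. (Product rule: $T(fg)=fTg+gTf$; chain rule: $T(\varphi(f))=\varphi'(f)Tf$ for smooth $\varphi$.) For a functional $\mathcal{S}$, $\mathbf{d}\mathcal{S}(\rho)$ is its Fréchet derivative: $(\mathbf{d}\mathcal{S}(\rho),g)=\frac{d}{d\epsilon}\mathcal{S}(\rho+\epsilon g)|_{\epsilon=0}$; in particular $\mathbf{d}\mathcal{S}_\mu(\rho)=\log(\rho/\mu)+1$. *)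

theory Defs
  imports "HOL-Probability.Probability"
begin

type_synonym 'n func = "real ^ 'n \<Rightarrow> real"
type_synonym 'n oper = "'n func \<Rightarrow> 'n func"

definition ae_eq :: "('n::finite) func \<Rightarrow> 'n func \<Rightarrow> bool" (infix "\<doteq>" 50) where
  "f \<doteq> g \<longleftrightarrow> (AE x in lborel. f x = g x)"

definition L2 :: "('n::finite) func \<Rightarrow> 'n func set" where
  "L2 w = {f \<in> borel_measurable borel. integrable lborel (\<lambda>x. (f x)\<^sup>2 * w x)}"

text \<open>The space \<open>L\<^sup>2\<close> with weight \<open>1/\<mu>\<close>, i.e. the dual of \<open>L2 \<mu>\<close> under the unweighted pairing
  \<open>(f,g) = \<integral> f g dx\<close>.  Densities and the values of operators acting on densities live here, so
  that their pairing with elements of \<open>L2 \<mu>\<close> is an absolutely convergent integral.\<close>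

definition L2_dual :: "('n::finite) func \<Rightarrow> 'n func set" where
  "L2_dual \<mu> = L2 (\<lambda>x. 1 / \<mu> x)"

definition pairing :: "('n::finite) func \<Rightarrow> 'n func \<Rightarrow> real" where
  "pairing f g = (LINT x|lborel. f x * g x)"

definition inner_w :: "('n::finite) func \<Rightarrow> 'n func \<Rightarrow> 'n func \<Rightarrow> real" where
  "inner_w w f g = (LINT x|lborel. f x * g x * w x)"

definition norm_w :: "('n::finite) func \<Rightarrow> 'n func \<Rightarrow> real" where
  "norm_w w f = sqrt (inner_w w f f)"

definition dense_in :: "('n::finite) func \<Rightarrow> 'n func set \<Rightarrow> 'n func set \<Rightarrow> bool" where
  "dense_in w D S \<longleftrightarrow> D \<subseteq> S \<and> (\<forall>f\<in>S. \<forall>e>0. \<exists>g\<in>D. norm_w w (\<lambda>x. f x - g x) < e)"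

text \<open>\<open>formal_adjoint X Y T' T\<close>: \<open>(T' u, f) = (u, T f)\<close> for \<open>u \<in> X\<close>, \<open>f \<in> Y\<close>.  The relation is
  symmetric in \<open>T\<close> and \<open>T'\<close>, so it also says \<open>(T')' = T\<close>.\<close>

definition formal_adjoint ::
  "('n::finite) func set \<Rightarrow> 'n func set \<Rightarrow> 'n oper \<Rightarrow> 'n oper \<Rightarrow> bool" where
  "formal_adjoint X Y T' T \<longleftrightarrow>
     (\<forall>u\<in>X. \<forall>f\<in>Y. integrable lborel (\<lambda>x. T' u x * f x) \<and>
                   integrable lborel (\<lambda>x. u x * T f x) \<and>
                   pairing (T' u) f = pairing u (T f))"

text \<open>\<open>L2_adjoint \<mu> V T u v\<close>: \<open>u\<close> is in the domain of the adjoint in \<open>L2 \<mu>\<close> of \<open>T\<close> (with domain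
  \<open>V\<close>), and \<open>T\<^sup>* u = v\<close>.\<close>

definition L2_adjoint ::
  "('n::finite) func \<Rightarrow> 'n func set \<Rightarrow> 'n oper \<Rightarrow> 'n func \<Rightarrow> 'n func \<Rightarrow> bool" where
  "L2_adjoint \<mu> V T u v \<longleftrightarrow>
     u \<in> L2 \<mu> \<and> v \<in> L2 \<mu> \<and> (\<forall>f\<in>V. inner_w \<mu> v f = inner_w \<mu> u (T f))"

definition smooth :: "(real \<Rightarrow> real) \<Rightarrow> bool" where
  "smooth \<phi> \<longleftrightarrow> (\<forall>k. (deriv ^^ k) \<phi> differentiable_on UNIV)"

definition linear_oper :: "('n::finite) func set \<Rightarrow> 'n oper \<Rightarrow> bool" where
  "linear_oper V T \<longleftrightarrow>
     (\<forall>f\<in>V. \<forall>g\<in>V. \<forall>a b. T (\<lambda>x. a * f x + b * g x) \<doteq> (\<lambda>x. a * T f x + b * T g x))"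

definition product_rule :: "('n::finite) func set \<Rightarrow> 'n oper \<Rightarrow> bool" where
  "product_rule V T \<longleftrightarrow>
     (\<forall>f\<in>V. \<forall>g\<in>V. T (\<lambda>x. f x * g x) \<doteq> (\<lambda>x. f x * T g x + g x * T f x))"

definition chain_rule :: "('n::finite) func set \<Rightarrow> 'n oper \<Rightarrow> bool" where
  "chain_rule V T \<longleftrightarrow>
     (\<forall>f\<in>V. \<forall>\<phi>. smooth \<phi> \<longrightarrow> T (\<lambda>x. \<phi> (f x)) \<doteq> (\<lambda>x. deriv \<phi> (f x) * T f x))"

text \<open>The closure properties that make the product rule and the chain rule meaningful on \<open>V\<close>.
  Example: Schwartz functions plus constants.\<close>

definition smooth_algebra :: "('n::finite) func set \<Rightarrow> bool" where
  "smooth_algebra V \<longleftrightarrow>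
     V \<noteq> {} \<and>
     (\<forall>f\<in>V. \<forall>g\<in>V. \<forall>a b. (\<lambda>x. a * f x + b * g x) \<in> V) \<and>
     (\<forall>f\<in>V. \<forall>g\<in>V. (\<lambda>x. f x * g x) \<in> V) \<and>
     (\<forall>f\<in>V. \<forall>\<phi>. smooth \<phi> \<longrightarrow> (\<lambda>x. \<phi> (f x)) \<in> V)"

text \<open>The densities \<open>\<rho>\<close> whose ratio \<open>h = \<rho>/\<mu>\<close> is in \<open>V\<close>, and the strictly positive elements
  \<open>\<rho>\<close> of \<open>V\<close> for which \<open>log (\<rho>/\<mu>)\<close> is again in \<open>V\<close>, so that operators on \<open>V\<close> can be applied
  to the derivative of the relative entropy.\<close>

definition dens :: "('n::finite) func \<Rightarrow> 'n func set \<Rightarrow> 'n func set" where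
  "dens \<mu> V = {\<rho>. (\<lambda>x. \<rho> x / \<mu> x) \<in> V}"

definition pos_dens :: "('n::finite) func \<Rightarrow> 'n func set \<Rightarrow> 'n func set" where
  "pos_dens \<mu> V = {\<rho> \<in> V. (\<forall>x. \<rho> x > 0) \<and> (\<lambda>x. ln (\<rho> x / \<mu> x)) \<in> V}"

definition transition_function ::
  "(real \<Rightarrow> real ^ 'n \<Rightarrow> (real ^ 'n::finite) measure) \<Rightarrow> bool" where
  "transition_function P \<longleftrightarrow>
     (\<forall>t\<ge>0. P t \<in> borel \<rightarrow>\<^sub>M prob_algebra borel) \<and>
     (\<forall>x. P 0 x = return borel x) \<and>
     (\<forall>s\<ge>0. \<forall>t\<ge>0. \<forall>x. P (s + t) x = P s x \<bind> P t)"

definition past :: "'w measure \<Rightarrow> (real \<Rightarrow> 'w \<Rightarrow> real ^ 'n::finite) \<Rightarrow> real \<Rightarrow> 'w measure" where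
  "past \<Omega> X s = sigma (space \<Omega>) {X r -` S \<inter> space \<Omega> | r S. 0 \<le> r \<and> r \<le> s \<and> S \<in> sets borel}"

definition markov_process ::
  "'w measure \<Rightarrow> (real \<Rightarrow> 'w \<Rightarrow> real ^ 'n) \<Rightarrow>
     (real \<Rightarrow> real ^ 'n \<Rightarrow> (real ^ 'n::finite) measure) \<Rightarrow> bool" where
  "markov_process \<Omega> X P \<longleftrightarrow>
     prob_space \<Omega> \<and> transition_function P \<and> (\<forall>t\<ge>0. X t \<in> borel_measurable \<Omega>) \<and>
     (\<forall>s\<ge>0. \<forall>t\<ge>0. \<forall>S\<in>sets borel. AE w in \<Omega>.
        real_cond_exp \<Omega> (past \<Omega> X s) (\<lambda>w. indicator S (X (s + t) w)) w = measure (P t (X s w)) S)"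

definition invariant ::
  "(real \<Rightarrow> real ^ 'n \<Rightarrow> (real ^ 'n) measure) \<Rightarrow> (real ^ 'n::finite) measure \<Rightarrow> bool" where
  "invariant P \<nu> \<longleftrightarrow> prob_space \<nu> \<and> sets \<nu> = sets borel \<and> (\<forall>t\<ge>0. \<nu> \<bind> P t = \<nu>)"

definition semigroup_op ::
  "(real \<Rightarrow> real ^ 'n \<Rightarrow> (real ^ 'n) measure) \<Rightarrow> real \<Rightarrow> ('n::finite) oper" where
  "semigroup_op P t f = (\<lambda>x. LINT y|P t x. f y)"

definition C0_contraction_semigroup ::
  "('n::finite) func \<Rightarrow> (real \<Rightarrow> real ^ 'n \<Rightarrow> (real ^ 'n) measure) \<Rightarrow> bool" where
  "C0_contraction_semigroup \<mu> P \<longleftrightarrow>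
     (\<forall>f\<in>L2 \<mu>.
        (\<forall>t\<ge>0. semigroup_op P t f \<in> L2 \<mu> \<and> norm_w \<mu> (semigroup_op P t f) \<le> norm_w \<mu> f) \<and>
        ((\<lambda>t. norm_w \<mu> (\<lambda>x. semigroup_op P t f x - f x)) \<longlongrightarrow> 0) (at_right 0))"

definition generator ::
  "('n::finite) func \<Rightarrow> (real \<Rightarrow> real ^ 'n \<Rightarrow> (real ^ 'n) measure) \<Rightarrow> 'n func \<Rightarrow> 'n func \<Rightarrow> bool" where
  "generator \<mu> P f g \<longleftrightarrow> f \<in> L2 \<mu> \<and> g \<in> L2 \<mu> \<and>
     ((\<lambda>t. norm_w \<mu> (\<lambda>x. (semigroup_op P t f x - f x) / t - g x)) \<longlongrightarrow> 0) (at_right 0)"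

definition generator_dom ::
  "('n::finite) func \<Rightarrow> (real \<Rightarrow> real ^ 'n \<Rightarrow> (real ^ 'n) measure) \<Rightarrow> 'n func set" where
  "generator_dom \<mu> P = {f. \<exists>g. generator \<mu> P f g}"

definition generator_adjoint_dom ::
  "('n::finite) func \<Rightarrow> (real \<Rightarrow> real ^ 'n \<Rightarrow> (real ^ 'n) measure) \<Rightarrow> 'n func set" where
  "generator_adjoint_dom \<mu> P =
     {u \<in> L2 \<mu>. \<exists>v\<in>L2 \<mu>. \<forall>f g. generator \<mu> P f g \<longrightarrow> inner_w \<mu> v f = inner_w \<mu> u g}"

text \<open>As operators take values in spaces of functions modulo null sets, the equation is required
  at each time for almost every \<open>x\<close>; classical solutions satisfy it.\<close>

definition evolves :: "('n::finite) oper \<Rightarrow> (real \<Rightarrow> 'n func) \<Rightarrow> bool" where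
  "evolves G u \<longleftrightarrow>
     (\<forall>t\<ge>0. AE x in lborel. ((\<lambda>s. u s x) has_real_derivative G (u t) x) (at t within {0..}))"

text \<open>All values \<open>\<rho>\<^sub>t\<close> of strictly positive classical solutions of \<open>\<partial>\<^sub>t \<rho>\<^sub>t = L' \<rho>\<^sub>t\<close> in
  \<open>L\<^sup>1 \<inter> L\<^sup>2\<close>.\<close>

definition positive_FP_solutions :: "('n::finite) oper \<Rightarrow> 'n func set" where
  "positive_FP_solutions L' =
     {\<rho> t | \<rho> t. t \<ge> 0 \<and>
        (\<forall>s\<ge>0. integrable lborel (\<rho> s) \<and> \<rho> s \<in> L2 (\<lambda>x. 1) \<and> (\<forall>x. \<rho> s x > 0) \<and>
               (\<forall>x. ((\<lambda>r. \<rho> r x) has_real_derivative L' (\<rho> s) x) (at s within {0..})))}"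

text \<open>Density of \<open>V\<close> in \<open>\<D>\<^sub>2(\<L>) \<inter> \<D>\<^sub>2(\<L>\<^sup>*)\<close> is with respect to the norm of \<open>L2 \<mu>\<close>; the
  density of that intersection in \<open>L2 \<mu>\<close> makes adjoints of operators defined on \<open>V\<close> unique.\<close>

definition kolmogorov_setting ::
  "'w measure \<Rightarrow> (real \<Rightarrow> 'w \<Rightarrow> real ^ 'n) \<Rightarrow> (real \<Rightarrow> real ^ 'n \<Rightarrow> (real ^ 'n) measure) \<Rightarrow>
     ('n::finite) func \<Rightarrow> 'n func set \<Rightarrow> 'n oper \<Rightarrow> 'n oper \<Rightarrow> bool" where
  "kolmogorov_setting \<Omega> X P \<mu> V L L' \<longleftrightarrow>
     markov_process \<Omega> X P \<and>
     \<mu> \<in> borel_measurable borel \<and> (\<forall>x. \<mu> x > 0) \<and>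
     (\<forall>\<nu>. invariant P \<nu> \<longleftrightarrow> \<nu> = density lborel (\<lambda>x. ennreal (\<mu> x))) \<and>
     C0_contraction_semigroup \<mu> P \<and>
     (\<forall>f g. generator \<mu> P f g \<longrightarrow> (g \<doteq> (\<lambda>x. 0)) = (\<exists>c. f \<doteq> (\<lambda>x. c))) \<and>
     smooth_algebra V \<and> \<mu> \<in> V \<and>
     dense_in \<mu> V (generator_dom \<mu> P \<inter> generator_adjoint_dom \<mu> P) \<and>
     dense_in \<mu> (generator_dom \<mu> P \<inter> generator_adjoint_dom \<mu> P) (L2 \<mu>) \<and>
     dense_in (\<lambda>x. 1) (pos_dens \<mu> V) (positive_FP_solutions L') \<and>
     (\<forall>f\<in>V. generator \<mu> P f (L f)) \<and>
     (\<forall>\<rho>\<in>dens \<mu> V. L' \<rho> \<in> L2_dual \<mu>) \<and>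
     formal_adjoint (dens \<mu> V) V L' L \<and>
     L' \<mu> \<doteq> (\<lambda>x. 0)"

definition rel_entropy :: "('n::finite) func \<Rightarrow> 'n func \<Rightarrow> real" where
  "rel_entropy \<mu> \<rho> = (LINT x|lborel. ln (\<rho> x / \<mu> x) * \<rho> x)"

text \<open>\<open>\<xi> = dS(\<rho>)\<close>, tested on directions \<open>g \<in> D\<close> for which \<open>\<rho> + \<epsilon> g\<close> stays
  positive for small \<open>\<epsilon>\<close>.\<close>

definition functional_derivative ::
  "('n::finite) func set \<Rightarrow> ('n func \<Rightarrow> real) \<Rightarrow> 'n func \<Rightarrow> 'n func \<Rightarrow> bool" where
  "functional_derivative D S \<rho> \<xi> \<longleftrightarrow>
     (\<forall>g\<in>D. (\<exists>C. \<forall>x. \<bar>g x\<bar> \<le> C * \<rho> x) \<longrightarrow>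
        integrable lborel (\<lambda>x. \<xi> x * g x) \<and>
        ((\<lambda>\<epsilon>. S (\<lambda>x. \<rho> x + \<epsilon> * g x)) has_real_derivative pairing \<xi> g) (at 0))"

definition quadratic_pre_GENERIC ::
  "('n::finite) func \<Rightarrow> 'n func set \<Rightarrow> ('n func \<Rightarrow> real) \<Rightarrow> 'n oper \<Rightarrow> 'n oper \<Rightarrow>
     ('n func \<Rightarrow> 'n oper) \<Rightarrow> bool" where
  "quadratic_pre_GENERIC \<mu> V S L' W M \<longleftrightarrow>
     (\<forall>\<rho>\<in>pos_dens \<mu> V.
        (\<forall>\<xi>\<in>V. M \<rho> \<xi> \<in> L2_dual \<mu>) \<and>
        formal_adjoint V V (M \<rho>) (M \<rho>) \<and>
        (\<forall>\<xi>\<in>V. pairing (M \<rho> \<xi>) \<xi> \<ge> 0) \<and>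
        (\<exists>\<xi>\<in>V. functional_derivative (dens \<mu> V) S \<rho> \<xi> \<and>
           L' \<rho> \<doteq> (\<lambda>x. W \<rho> x - M \<rho> (\<lambda>y. 1/2 * \<xi> y) x) \<and>
           pairing (W \<rho>) \<xi> = 0))"

text \<open>\<open>R\<close> is a square root \<open>M\<^sub>\<rho>\<^sup>1\<^sup>/\<^sup>2\<close> with components \<open>R i\<close>, and \<open>(M\<^sub>\<rho>\<^sup>1\<^sup>/\<^sup>2)' M\<^sub>\<rho>\<^sup>1\<^sup>/\<^sup>2\<close> is
  \<open>\<Sum>\<^sub>i (R i)' (R i)\<close>, in accordance with \<open>A\<^sup>*A = \<Sum>\<^sub>i A\<^sub>i\<^sup>*A\<^sub>i\<close>.\<close>

definition square_root_of ::
  "('n::finite) func \<Rightarrow> 'n func set \<Rightarrow> 'n oper \<Rightarrow> ('n \<Rightarrow> 'n oper) \<Rightarrow> bool" where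
  "square_root_of \<mu> V N R \<longleftrightarrow>
     (\<exists>R'. (\<forall>i. formal_adjoint (R i ` V) V (R' i) (R i)) \<and>
           (\<forall>i. \<forall>\<xi>\<in>V. R' i (R i \<xi>) \<in> L2_dual \<mu>) \<and>
           (\<forall>\<xi>\<in>V. N \<xi> \<doteq> (\<lambda>x. \<Sum>i\<in>UNIV. R' i (R i \<xi>) x)))"

text \<open>\<open>As i\<close> is the adjoint of \<open>A i\<close> in \<open>L2 \<mu>\<close>, on the range of \<open>A i\<close>.\<close>

definition linear_hypocoercive_form ::
  "('n::finite) func \<Rightarrow> 'n func set \<Rightarrow> 'n oper \<Rightarrow> 'n oper \<Rightarrow> ('n \<Rightarrow> 'n oper) \<Rightarrow>
     ('n \<Rightarrow> 'n oper) \<Rightarrow> bool" where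
  "linear_hypocoercive_form \<mu> V L B A As \<longleftrightarrow>
     linear_oper V L \<and>
     (\<forall>f\<in>V. B f \<in> L2 \<mu>) \<and> linear_oper V B \<and> chain_rule V B \<and> product_rule V B \<and>
     (\<forall>f\<in>V. L2_adjoint \<mu> V B f (\<lambda>x. - B f x)) \<and>
     (\<forall>i. (\<forall>f\<in>V. A i f \<in> L2 \<mu>) \<and> linear_oper V (A i) \<and> chain_rule V (A i) \<and>
          (\<forall>f\<in>V. L2_adjoint \<mu> V (A i) (A i f) (As i (A i f)))) \<and>
     (\<forall>f\<in>V. L f \<doteq> (\<lambda>x. B f x - (\<Sum>i\<in>UNIV. As i (A i f) x)))"

end

theory Submission
  imports Defs
begin

text \<open>
  Write \<open>\<langle>f, g\<rangle>\<close> for the scalar product of \<open>L\<^sup>2\<close> with weight \<open>\<mu>\<close>.  The test functions \<open>V\<close> are dense in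
  that space, so every identity between operators follows once it has been tested against \<open>V\<close>;
  linearity of \<open>L\<close>, \<open>W'\<close> and \<open>A\<close> is obtained in the same way.

  The densities on which the quadratic structure acts are exactly \<open>\<rho> = \<mu> e\<^sup>\<eta>\<close> with \<open>\<eta> \<in> V\<close>, and the
  derivative of the relative entropy there is \<open>\<eta> + 1\<close>
  (\<open>functional_derivative_rel_entropy_unique\<close>).  The root of \<open>M\<^sub>\<rho>\<close> turns \<open>(M\<^sub>\<rho> \<xi>, f)\<close> into
  \<open>2 \<Sum>\<^sub>i \<integral> \<rho> (A\<^sub>i \<xi>) (A\<^sub>i f) dx\<close>.  By the chain rule, \<open>A\<^sub>i\<close> kills constants and
  \<open>\<rho> A\<^sub>i \<eta> = \<mu> A\<^sub>i e\<^sup>\<eta>\<close>: the nonlinear term \<open>M\<^sub>\<rho>(dS(\<rho>)/2)\<close> is therefore linear in the ratio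
  \<open>h = \<rho>/\<mu> = e\<^sup>\<eta>\<close>, and testing the dynamics with \<open>f\<close> gives
  \<open>(L' \<rho>, f) = (W \<rho>, f) - \<Sum>\<^sub>i \<langle>A\<^sub>i h, A\<^sub>i f\<rangle>\<close> (\<open>weak_equation_exp\<close>).

  Two consequences finish the argument.  At \<open>h = 1\<close> stationarity of \<open>\<mu>\<close> leaves \<open>W \<mu> = 0\<close>, which
  together with the product rule for \<open>W'\<close> is antisymmetry:
  \<open>0 = (W \<mu>, f g) = \<langle>1, W'(f g)\<rangle> = \<langle>f, W' g\<rangle> + \<langle>g, W' f\<rangle>\<close> (\<open>W'_antisymmetric\<close>).  And since every
  element of \<open>V\<close> is a linear combination of two exponentials of elements of \<open>V\<close>, the identity
  extends to \<open>\<langle>h, L f\<rangle> = \<langle>h, W' f\<rangle> - \<Sum>\<^sub>i \<langle>A\<^sub>i h, A\<^sub>i f\<rangle>\<close> for all \<open>h \<in> V\<close> (\<open>weak_equation\<close>).  Read as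
  an equation for \<open>L f\<close> this is \<open>L = W' - A\<^sup>*A\<close>; read as one for \<open>L'(\<mu> h)\<close> it is the evolution
  equation of \<open>h\<close>.
\<close>

section \<open>Smooth scalar functions\<close>

lemma smooth_if_closed_under_deriv:
  assumes "\<phi> \<in> F" and "\<And>g. g \<in> F \<Longrightarrow> \<exists>g'\<in>F. \<forall>x. (g has_real_derivative g' x) (at x)"
  shows "smooth \<phi>"
proof -
  have deriv: "g differentiable_on UNIV \<and> deriv g \<in> F" if "g \<in> F" for g
  proof -
    obtain g' where g': "g' \<in> F" "\<And>x. (g has_real_derivative g' x) (at x)"
      using assms(2)[OF \<open>g \<in> F\<close>] by blast
    then have "deriv g = g'" by (auto intro!: ext DERIV_imp_deriv)
    with g' show ?thesis
      by (auto simp: differentiable_on_def real_differentiable_def)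
  qed
  have "(deriv ^^ k) \<phi> \<in> F" for k
    by (induction k) (use deriv \<open>\<phi> \<in> F\<close> in auto)
  then show ?thesis using deriv by (auto simp: smooth_def)
qed

lemma smooth_const: "smooth (\<lambda>_. c)"
  by (rule smooth_if_closed_under_deriv[where F = "range (\<lambda>c _. c)"])
     (auto intro!: exI[of _ 0])

lemma smooth_exp: "smooth exp"
  by (rule smooth_if_closed_under_deriv[where F = "{exp}"]) (auto intro: DERIV_exp)

text \<open>The functions \<open>p(t) / (1 + t\<^sup>2)\<^sup>k\<close> with \<open>p\<close> a polynomial are closed under differentiation
  and contain the derivative of \<open>ln (1 + t\<^sup>2)\<close>.  This function is what makes \<open>1 + g\<^sup>2\<close> the
  exponential of an element of the algebra, for every \<open>g\<close> in it.\<close>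

lemma smooth_ln_1_plus_square: "smooth (\<lambda>t. ln (1 + t\<^sup>2))"
proof -
  define R :: "real poly \<Rightarrow> nat \<Rightarrow> real \<Rightarrow> real" where "R p k t = poly p t / (1 + t\<^sup>2) ^ k" for p k t
  have pos: "1 + t\<^sup>2 > 0" for t :: real by (simp add: add_pos_nonneg)
  show ?thesis
  proof (rule smooth_if_closed_under_deriv)
    show "(\<lambda>t. ln (1 + t\<^sup>2)) \<in> insert (\<lambda>t. ln (1 + t\<^sup>2)) (range (case_prod R))" by simp
  next
    fix g assume "g \<in> insert (\<lambda>t::real. ln (1 + t\<^sup>2)) (range (case_prod R))"
    then consider "g = (\<lambda>t. ln (1 + t\<^sup>2))" | p k where "g = R p k" by auto
    then obtain p k where "\<forall>x. (g has_real_derivative R p k x) (at x)"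
    proof cases
      case 1
      have "(g has_real_derivative R [:0, 2:] 1 x) (at x)" for x
        unfolding 1 R_def using pos[of x] by (auto intro!: derivative_eq_intros)
      then show ?thesis using that by blast
    next
      case (2 p k)
      let ?q = "pderiv p * [:1, 0, 1:] - smult (2 * real k) ([:0, 1:] * p)"
      have "(g has_real_derivative R ?q (Suc k) x) (at x)" for x
      proof -
        define u where "u = 1 + x\<^sup>2"
        have u: "u \<noteq> 0" using pos[of x] by (simp add: u_def)
        have "((\<lambda>t. 1 + t\<^sup>2) has_real_derivative 2 * x) (at x)"
          by (auto intro!: derivative_eq_intros)
        from DERIV_power[OF this, of k]
        have "((\<lambda>t. (1 + t\<^sup>2) ^ k) has_real_derivative real k * (2 * x * u ^ (k - 1))) (at x)"
          by (simp add: u_def)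
        from DERIV_divide[OF poly_DERIV this, of p]
        have "(g has_real_derivative
            (poly (pderiv p) x * u ^ k - poly p x * (real k * (2 * x * u ^ (k - 1)))) / (u ^ k * u ^ k)) (at x)"
          using u by (simp add: 2 R_def[abs_def] u_def)
        also have "(poly (pderiv p) x * u ^ k - poly p x * (real k * (2 * x * u ^ (k - 1)))) / (u ^ k * u ^ k)
            = (poly (pderiv p) x * u - 2 * real k * x * poly p x) / u ^ Suc k"
        proof (cases k)
          case (Suc m)
          have "(poly (pderiv p) x * u ^ k - poly p x * (real k * (2 * x * u ^ (k - 1)))) / (u ^ k * u ^ k)
              = u ^ m * (poly (pderiv p) x * u - 2 * real k * x * poly p x) / (u ^ m * u ^ Suc k)"
            by (simp add: Suc algebra_simps)
          then show ?thesis using u by simp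
        qed (use u in simp)
        also have "\<dots> = R ?q (Suc k) x"
          unfolding R_def u_def[symmetric] by (simp add: u_def algebra_simps power2_eq_square)
        finally show ?thesis .
      qed
      then show ?thesis using that by blast
    qed
    then show "\<exists>g'\<in>insert (\<lambda>t. ln (1 + t\<^sup>2)) (range (case_prod R)).
                 \<forall>x. (g has_real_derivative g' x) (at x)"
      by (intro bexI[of _ "R p k"]) auto
  qed
qed

section \<open>Weighted square-integrable functions\<close>

lemma L2_mult_integrable:
  assumes w: "w \<in> borel_measurable borel" "\<And>x. w x \<ge> 0" and fg: "f \<in> L2 w" "g \<in> L2 w"
  shows "integrable lborel (\<lambda>x. f x * g x * w x)"
proof (rule Bochner_Integration.integrable_bound)
  show "integrable lborel (\<lambda>x. (f x)\<^sup>2 * w x + (g x)\<^sup>2 * w x)"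
    using fg by (auto simp: L2_def)
  show "(\<lambda>x. f x * g x * w x) \<in> borel_measurable lborel"
    using w fg by (auto simp: L2_def)
  have bound: "\<bar>f x * g x * w x\<bar> \<le> (f x)\<^sup>2 * w x + (g x)\<^sup>2 * w x" for x
  proof -
    have "\<bar>f x * g x\<bar> \<le> (f x)\<^sup>2 + (g x)\<^sup>2"
    proof -
      have "0 \<le> (\<bar>f x\<bar> - \<bar>g x\<bar>)\<^sup>2" by simp
      then have "2 * \<bar>f x * g x\<bar> \<le> (f x)\<^sup>2 + (g x)\<^sup>2"
        by (simp add: power2_diff abs_mult)
      then show ?thesis using abs_ge_zero[of "f x * g x"] by linarith
    qed
    from mult_right_mono[OF this w(2)[of x]] show ?thesis
      using w(2)[of x] by (simp add: abs_mult distrib_right)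
  qed
  show "AE x in lborel. norm (f x * g x * w x) \<le> norm ((f x)\<^sup>2 * w x + (g x)\<^sup>2 * w x)"
    unfolding real_norm_def by (intro AE_I2 order_trans[OF bound abs_ge_self])
qed

lemma L2_lincomb:
  assumes w: "w \<in> borel_measurable borel" "\<And>x. w x \<ge> 0" and fg: "f \<in> L2 w" "g \<in> L2 w"
  shows "(\<lambda>x. a * f x + b * g x) \<in> L2 w"
proof -
  have "integrable lborel (\<lambda>x. a\<^sup>2 * ((f x)\<^sup>2 * w x) + 2 * a * b * (f x * g x * w x)
           + b\<^sup>2 * ((g x)\<^sup>2 * w x))"
    using fg L2_mult_integrable[OF assms] by (auto simp: L2_def)
  moreover have "(\<lambda>x. a\<^sup>2 * ((f x)\<^sup>2 * w x) + 2 * a * b * (f x * g x * w x) + b\<^sup>2 * ((g x)\<^sup>2 * w x))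
      = (\<lambda>x. (a * f x + b * g x)\<^sup>2 * w x)"
    by (auto simp: power2_eq_square algebra_simps)
  ultimately show ?thesis using fg by (auto simp: L2_def)
qed

lemma inner_w_commute: "inner_w w f g = inner_w w g f"
  by (simp add: inner_w_def mult.commute)

lemma inner_w_lincomb:
  assumes w: "w \<in> borel_measurable borel" "\<And>x. w x \<ge> 0"
    and "f \<in> L2 w" "g \<in> L2 w" "k \<in> L2 w"
  shows "inner_w w (\<lambda>x. a * f x + b * g x) k = a * inner_w w f k + b * inner_w w g k"
proof -
  have "inner_w w (\<lambda>x. a * f x + b * g x) k
      = (LINT x|lborel. a * (f x * k x * w x) + b * (g x * k x * w x))"
    by (simp add: inner_w_def algebra_simps)
  also have "\<dots> = a * inner_w w f k + b * inner_w w g k"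
    using L2_mult_integrable[OF w] assms(3-5) by (simp add: inner_w_def)
  finally show ?thesis .
qed

lemma inner_w_cong_AE:
  assumes "w \<in> borel_measurable borel" "f \<in> borel_measurable borel" "f' \<in> borel_measurable borel"
    "g \<in> borel_measurable borel" "f \<doteq> f'"
  shows "inner_w w f g = inner_w w f' g"
  unfolding inner_w_def
  by (rule integral_cong_AE) (use assms in \<open>auto simp: ae_eq_def\<close>)

lemma inner_w_self_eq_0:
  assumes "\<And>x. w x > 0" and f: "f \<in> L2 w" and "inner_w w f f = 0"
  shows "f \<doteq> (\<lambda>x. 0)"
proof -
  have "AE x in lborel. (f x)\<^sup>2 * w x = 0"
  proof (subst integral_nonneg_eq_0_iff_AE[symmetric])
    show "integrable lborel (\<lambda>x. (f x)\<^sup>2 * w x)" using f by (simp add: L2_def)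
    show "AE x in lborel. 0 \<le> (f x)\<^sup>2 * w x" using less_imp_le[OF assms(1)] by auto
    show "(LINT x|lborel. (f x)\<^sup>2 * w x) = 0"
      using assms(3) by (simp add: inner_w_def power2_eq_square)
  qed
  then show ?thesis unfolding ae_eq_def
  proof eventually_elim
    case (elim x)
    then show ?case using assms(1)[of x] by simp
  qed
qed

lemma orthogonal_to_dense:
  assumes w: "w \<in> borel_measurable borel" "\<And>x. w x \<ge> 0"
    and dense: "dense_in w D S" and S: "S \<subseteq> L2 w" and u: "u \<in> L2 w"
    and orth: "\<And>g. g \<in> D \<Longrightarrow> inner_w w u g = 0" and f: "f \<in> S"
  shows "inner_w w u f = 0"
proof (rule ccontr)
  define c where "c = inner_w w u f"
  assume "inner_w w u f \<noteq> 0"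
  then have "c \<noteq> 0" by (simp add: c_def)
  define N where "N = inner_w w u u"
  have sq_nonneg: "inner_w w h h \<ge> 0" for h
    unfolding inner_w_def by (rule integral_nonneg_AE) (use w in auto)
  have N: "N \<ge> 0" using sq_nonneg by (simp add: N_def)
  \<comment> \<open>For every approximant \<open>g\<close> of \<open>f\<close>, the polynomial \<open>t \<mapsto> |(f - g) - t u|\<^sup>2\<close> is nonnegative;
    at \<open>t = c / (N + 1)\<close> this bounds \<open>|f - g|\<close> away from \<open>0\<close>.\<close>
  have lower: "c\<^sup>2 / (N + 1) \<le> inner_w w (\<lambda>x. f x - g x) (\<lambda>x. f x - g x)" if "g \<in> D" for g
  proof -
    have g: "g \<in> L2 w" and fL: "f \<in> L2 w" using dense that S f by (auto simp: dense_in_def)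
    define d where "d = (\<lambda>x. f x - g x)"
    have d: "d \<in> L2 w" using L2_lincomb[OF w fL g, of 1 "-1"] by (simp add: d_def)
    have ud: "inner_w w d u = c"
      using inner_w_lincomb[OF w fL g u, of 1 "-1"] orth[OF that]
      by (simp add: d_def c_def inner_w_commute[of w _ u])
    define t where "t = c / (N + 1)"
    define k where "k = (\<lambda>x. 1 * d x + (- t) * u x)"
    have k: "k \<in> L2 w" unfolding k_def by (rule L2_lincomb[OF w d u])
    have kin: "inner_w w k z = inner_w w d z - t * inner_w w u z" if "z \<in> L2 w" for z
      unfolding k_def by (subst inner_w_lincomb[OF w d u that]) simp
    have "inner_w w k d = inner_w w d d - t * c"
      using kin[OF d] ud by (simp add: inner_w_commute[of w u d])
    moreover have "inner_w w k u = c - t * N" using kin[OF u] ud by (simp add: N_def)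
    ultimately have "inner_w w k k = inner_w w d d - t * c - t * (c - t * N)"
      using kin[OF k] by (simp add: inner_w_commute[of w d k] inner_w_commute[of w u k])
    then have "inner_w w d d \<ge> t * c + t * (c - t * N)" using sq_nonneg[of k] by linarith
    moreover have "t * c = c\<^sup>2 / (N + 1)" by (simp add: t_def power2_eq_square)
    moreover have "t * (c - t * N) \<ge> 0"
    proof -
      have "c - t * N = t" using N by (simp add: t_def field_simps)
      then show ?thesis by simp
    qed
    ultimately show ?thesis unfolding d_def by linarith
  qed
  have "sqrt (c\<^sup>2 / (N + 1)) > 0" using \<open>c \<noteq> 0\<close> N by simp
  then obtain g where "g \<in> D" "norm_w w (\<lambda>x. f x - g x) < sqrt (c\<^sup>2 / (N + 1))"
    using dense f unfolding dense_in_def by blast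
  then show False using lower[of g] by (simp add: norm_w_def)
qed

section \<open>The algebra of test functions\<close>

text \<open>Density of the test functions enters in the form \<open>total\<close>: an operator identity may be proved
  by pairing both sides with every element of \<open>V\<close>.\<close>

locale test_space =
  fixes \<mu> :: "('n::finite) func" and V :: "'n func set"
  assumes mu_meas: "\<mu> \<in> borel_measurable borel" and mu_pos: "\<And>x. \<mu> x > 0"
    and algebra: "smooth_algebra V" and mu_V: "\<mu> \<in> V" and V_L2: "V \<subseteq> L2 \<mu>"
    and total: "\<And>u. u \<in> L2 \<mu> \<Longrightarrow> (\<And>f. f \<in> V \<Longrightarrow> inner_w \<mu> u f = 0) \<Longrightarrow> u \<doteq> (\<lambda>x. 0)"
begin

lemma mu_nonneg: "\<mu> x \<ge> 0" and mu_nz: "\<mu> x \<noteq> 0"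
  using mu_pos[of x] by auto

lemma V_lincomb: "f \<in> V \<Longrightarrow> g \<in> V \<Longrightarrow> (\<lambda>x. a * f x + b * g x) \<in> V"
  and V_mult: "f \<in> V \<Longrightarrow> g \<in> V \<Longrightarrow> (\<lambda>x. f x * g x) \<in> V"
  and V_comp: "f \<in> V \<Longrightarrow> smooth \<phi> \<Longrightarrow> (\<lambda>x. \<phi> (f x)) \<in> V"
  using algebra unfolding smooth_algebra_def by blast+

lemma V_const: "(\<lambda>x. c) \<in> V"
  using V_comp[OF mu_V smooth_const] .

lemma V_exp: "f \<in> V \<Longrightarrow> (\<lambda>x. exp (f x)) \<in> V"
  by (rule V_comp[OF _ smooth_exp])

lemma V_scale: "f \<in> V \<Longrightarrow> (\<lambda>x. a * f x) \<in> V"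
  using V_lincomb[of f f a 0] by simp

lemma V_add: "f \<in> V \<Longrightarrow> g \<in> V \<Longrightarrow> (\<lambda>x. f x + g x) \<in> V"
  using V_lincomb[of f g 1 1] by simp

lemma V_diff: "f \<in> V \<Longrightarrow> g \<in> V \<Longrightarrow> (\<lambda>x. f x - g x) \<in> V"
  using V_lincomb[of f g 1 "-1"] by simp

lemma V_in_L2: "f \<in> V \<Longrightarrow> f \<in> L2 \<mu>"
  using V_L2 by blast

lemma L2_measurable: "f \<in> L2 w \<Longrightarrow> f \<in> borel_measurable borel"
  by (simp add: L2_def)

lemma V_measurable: "f \<in> V \<Longrightarrow> f \<in> borel_measurable borel"
  by (rule L2_measurable[OF V_in_L2])

lemmas L2_mu_mult_integrable = L2_mult_integrable[OF mu_meas mu_nonneg]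
lemmas L2_mu_lincomb = L2_lincomb[OF mu_meas mu_nonneg]
lemmas inner_mu_lincomb = inner_w_lincomb[OF mu_meas mu_nonneg]

lemma inner_mu_lincomb_right:
  "f \<in> L2 \<mu> \<Longrightarrow> g \<in> L2 \<mu> \<Longrightarrow> k \<in> L2 \<mu> \<Longrightarrow>
    inner_w \<mu> k (\<lambda>x. a * f x + b * g x) = a * inner_w \<mu> k f + b * inner_w \<mu> k g"
  using inner_mu_lincomb[of f g k a b] by (simp add: inner_w_commute[of \<mu> k])

lemma total_eqI:
  assumes u: "u \<in> L2 \<mu>" and v: "v \<in> L2 \<mu>"
    and eq: "\<And>f. f \<in> V \<Longrightarrow> inner_w \<mu> u f = inner_w \<mu> v f"
  shows "u \<doteq> v"
proof -
  have "(\<lambda>x. 1 * u x + (-1) * v x) \<doteq> (\<lambda>x. 0)"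
    by (rule total[OF L2_mu_lincomb[OF u v]]) (subst inner_mu_lincomb[OF u v V_in_L2], auto simp: eq)
  then show ?thesis by (simp add: ae_eq_def)
qed

lemma L2_dual_iff: "u \<in> L2_dual \<mu> \<longleftrightarrow> (\<lambda>x. u x / \<mu> x) \<in> L2 \<mu>"
proof -
  have "(\<lambda>x. u x / \<mu> x) \<in> borel_measurable borel \<longleftrightarrow> u \<in> borel_measurable borel"
  proof
    assume "(\<lambda>x. u x / \<mu> x) \<in> borel_measurable borel"
    from borel_measurable_times[OF this mu_meas] show "u \<in> borel_measurable borel"
      by (simp add: mu_nz)
  qed (use mu_meas in simp)
  moreover have "(\<lambda>x. (u x / \<mu> x)\<^sup>2 * \<mu> x) = (\<lambda>x. (u x)\<^sup>2 * (1 / \<mu> x))"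
    using mu_nz by (auto simp: field_simps power2_eq_square)
  ultimately show ?thesis by (simp add: L2_dual_def L2_def)
qed

lemma L2_dual_mu_mult: "(\<lambda>x. \<mu> x * h x) \<in> L2_dual \<mu> \<longleftrightarrow> h \<in> L2 \<mu>"
  by (simp add: L2_dual_iff mu_nz)

lemma pairing_dual: "pairing u f = inner_w \<mu> (\<lambda>x. u x / \<mu> x) f"
  by (simp add: pairing_def inner_w_def mu_nz)

lemma pairing_mu_mult: "pairing (\<lambda>x. \<mu> x * h x) f = inner_w \<mu> h f"
  by (simp add: pairing_dual mu_nz)

lemma pairing_integrable:
  assumes "u \<in> L2_dual \<mu>" "f \<in> L2 \<mu>" shows "integrable lborel (\<lambda>x. u x * f x)"
  using L2_mu_mult_integrable[of "\<lambda>x. u x / \<mu> x" f] assms by (simp add: L2_dual_iff mu_nz)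

lemma L2_dual_measurable: "u \<in> L2_dual \<mu> \<Longrightarrow> u \<in> borel_measurable borel"
  by (simp add: L2_dual_def L2_def)

lemma pairing_commute: "pairing u f = pairing f u"
  by (simp add: pairing_def mult.commute)

lemma pairing_cong_AE:
  assumes "u \<in> borel_measurable borel" "v \<in> borel_measurable borel" "f \<in> borel_measurable borel"
    "u \<doteq> v"
  shows "pairing u f = pairing v f"
  unfolding pairing_def by (rule integral_cong_AE) (use assms in \<open>auto simp: ae_eq_def\<close>)

lemma dual_eqI:
  assumes "u \<in> L2_dual \<mu>" "v \<in> L2_dual \<mu>" "\<And>f. f \<in> V \<Longrightarrow> pairing u f = pairing v f"
  shows "u \<doteq> v"
proof -
  have "(\<lambda>x. u x / \<mu> x) \<doteq> (\<lambda>x. v x / \<mu> x)"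
    by (rule total_eqI) (use assms in \<open>auto simp: L2_dual_iff pairing_dual\<close>)
  then show ?thesis by (simp add: ae_eq_def mu_nz)
qed

lemma mu_mult_in_dens: "h \<in> V \<Longrightarrow> (\<lambda>x. \<mu> x * h x) \<in> dens \<mu> V"
  by (simp add: dens_def mu_nz)

lemma pos_dens_eq: "pos_dens \<mu> V = (\<lambda>\<eta> x. \<mu> x * exp (\<eta> x)) ` V"
proof (intro equalityI subsetI)
  fix \<rho> assume \<rho>: "\<rho> \<in> pos_dens \<mu> V"
  have "\<rho> = (\<lambda>x. \<mu> x * exp (ln (\<rho> x / \<mu> x)))"
    using \<rho> mu_pos by (auto simp: pos_dens_def mu_nz)
  then show "\<rho> \<in> (\<lambda>\<eta> x. \<mu> x * exp (\<eta> x)) ` V" using \<rho> by (auto simp: pos_dens_def)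
next
  fix \<rho> assume "\<rho> \<in> (\<lambda>\<eta> x. \<mu> x * exp (\<eta> x)) ` V"
  then show "\<rho> \<in> pos_dens \<mu> V"
    using V_mult[OF mu_V V_exp] mu_pos by (auto simp: pos_dens_def mu_nz)
qed

lemma mu_in_pos_dens: "\<mu> \<in> pos_dens \<mu> V"
  unfolding pos_dens_eq by (rule image_eqI[OF _ V_const[of 0]]) simp

text \<open>The identity \<open>4 h = (1 + (1 + h)\<^sup>2) - (1 + (1 - h)\<^sup>2)\<close>, where both brackets are exponentials
  of elements of \<open>V\<close>.  It carries identities known for ratios \<open>h = e\<^sup>\<eta>\<close> of positive densities over
  to arbitrary \<open>h \<in> V\<close>, without any limit.\<close>

lemma V_difference_of_exponentials:
  assumes "h \<in> V"
  obtains \<eta> \<theta> where "\<eta> \<in> V" "\<theta> \<in> V" "h = (\<lambda>x. (1/4) * exp (\<eta> x) + (- 1/4) * exp (\<theta> x))"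
proof
  let ?l = "\<lambda>t::real. ln (1 + t\<^sup>2)"
  show "(\<lambda>x. ?l (1 * 1 + 1 * h x)) \<in> V" "(\<lambda>x. ?l (1 * 1 + (-1) * h x)) \<in> V"
    by (intro V_comp[OF _ smooth_ln_1_plus_square] V_lincomb V_const assms)+
  have "exp (?l t) = 1 + t\<^sup>2" for t by (simp add: add_pos_nonneg)
  then show "h = (\<lambda>x. (1/4) * exp (?l (1 * 1 + 1 * h x)) + (- 1/4) * exp (?l (1 * 1 + (-1) * h x)))"
    by (simp only:) (simp add: power2_eq_square algebra_simps)
qed

text \<open>Linearity is forced by duality: \<open>\<langle>T f, h\<rangle> = (T'(\<mu> h), f)\<close> is linear in \<open>f\<close>, and \<open>V\<close>
  separates points.\<close>

lemma adjoint_imp_linear: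
  assumes adj: "formal_adjoint (dens \<mu> V) V T' T" and T: "\<And>f. f \<in> V \<Longrightarrow> T f \<in> L2 \<mu>"
  shows "linear_oper V T"
  unfolding linear_oper_def
proof (intro ballI allI)
  fix f g a b assume f: "f \<in> V" and g: "g \<in> V"
  show "T (\<lambda>x. a * f x + b * g x) \<doteq> (\<lambda>x. a * T f x + b * T g x)"
  proof (rule total_eqI)
    fix h assume h: "h \<in> V"
    let ?u = "\<lambda>x. \<mu> x * h x"
    have weak: "inner_w \<mu> (T k) h = pairing (T' ?u) k" and int: "integrable lborel (\<lambda>x. T' ?u x * k x)"
      if "k \<in> V" for k
      using adj mu_mult_in_dens[OF h] that
      by (auto simp: formal_adjoint_def pairing_mu_mult inner_w_commute[of \<mu> "T k"])
    have "pairing (T' ?u) (\<lambda>x. a * f x + b * g x) = (LINT x|lborel. a * (T' ?u x * f x) + b * (T' ?u x * g x))"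
      by (simp add: pairing_def algebra_simps)
    also have "\<dots> = a * pairing (T' ?u) f + b * pairing (T' ?u) g"
      using int f g by (simp add: pairing_def)
    finally show "inner_w \<mu> (T (\<lambda>x. a * f x + b * g x)) h = inner_w \<mu> (\<lambda>x. a * T f x + b * T g x) h"
      using f g h by (simp add: weak V_lincomb inner_mu_lincomb T V_in_L2)
  qed (use f g in \<open>auto intro!: T V_lincomb L2_mu_lincomb\<close>)
qed

end

section \<open>The derivative of the relative entropy\<close>

lemma DERIV_at_0_if_quadratic_remainder:
  fixes F :: "real \<Rightarrow> real"
  assumes "\<And>\<epsilon>. \<bar>\<epsilon>\<bar> < 1 \<Longrightarrow> \<bar>F \<epsilon> - F 0 - \<epsilon> * D\<bar> \<le> K * \<epsilon>\<^sup>2"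
  shows "(F has_real_derivative D) (at 0)"
  unfolding DERIV_def
proof (rule LIM_zero_cancel, rule Lim_null_comparison)
  have "\<forall>\<^sub>F \<epsilon> in at 0. \<epsilon> \<noteq> 0 \<and> \<bar>\<epsilon>\<bar> < (1::real)"
    unfolding eventually_at by (rule exI[of _ 1]) (auto simp: dist_real_def)
  then show "\<forall>\<^sub>F \<epsilon> in at 0. norm ((F (0 + \<epsilon>) - F 0) / \<epsilon> - D) \<le> K * \<bar>\<epsilon>\<bar>"
  proof eventually_elim
    case (elim \<epsilon>)
    then have "(F (0 + \<epsilon>) - F 0) / \<epsilon> - D = (F \<epsilon> - F 0 - \<epsilon> * D) / \<epsilon>"
      by (simp add: diff_divide_distrib)
    then have "norm ((F (0 + \<epsilon>) - F 0) / \<epsilon> - D) = \<bar>F \<epsilon> - F 0 - \<epsilon> * D\<bar> / \<bar>\<epsilon>\<bar>"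
      by (simp add: abs_divide)
    also have "\<dots> \<le> K * \<epsilon>\<^sup>2 / \<bar>\<epsilon>\<bar>" using assms[of \<epsilon>] elim by (intro divide_right_mono) auto
    also have "\<dots> = K * \<bar>\<epsilon>\<bar>" using elim by (simp add: power2_eq_square abs_if)
    finally show ?case .
  qed
  show "((\<lambda>\<epsilon>. K * \<bar>\<epsilon>\<bar>) \<longlongrightarrow> 0) (at 0)"
    by (auto intro!: tendsto_eq_intros)
qed

text \<open>The second-order remainder of \<open>(1 + t) ln (1 + t)\<close>; both bounds come from
  \<open>ln s \<le> s - 1\<close>, at \<open>s = 1 + t\<close> and at \<open>s = 1 / (1 + t)\<close>.\<close>

lemma entropy_remainder_bounds:
  fixes t :: real assumes "\<bar>t\<bar> < 1"
  shows "0 \<le> (1 + t) * ln (1 + t) - t" and "(1 + t) * ln (1 + t) - t \<le> t\<^sup>2"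
proof -
  have pos: "1 + t > 0" using assms by linarith
  have "ln (1 + t) \<le> t" using ln_le_minus_one[OF pos] by simp
  from mult_left_mono[OF this, of "1 + t"] pos show "(1 + t) * ln (1 + t) - t \<le> t\<^sup>2"
    by (simp add: algebra_simps power2_eq_square)
  have "ln (inverse (1 + t)) \<le> inverse (1 + t) - 1"
    using pos by (intro ln_le_minus_one) simp
  moreover have "1 - inverse (1 + t) = t / (1 + t)" using pos by (simp add: field_simps)
  ultimately have "t / (1 + t) \<le> ln (1 + t)" using pos by (simp add: ln_inverse)
  from mult_left_mono[OF this, of "1 + t"] pos show "0 \<le> (1 + t) * ln (1 + t) - t"
    by simp
qed

context test_space
begin

text \<open>Along \<open>\<rho> (1 + \<epsilon> b)\<close> the integrand of the entropy is exactly
  \<open>\<eta> \<rho> + \<epsilon> (\<eta> + 1) \<rho> b + \<rho> r(\<epsilon> b)\<close> with \<open>r(t) = (1 + t) ln (1 + t) - t\<close>, because the terms in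
  \<open>\<eta>\<close> are affine in \<open>\<epsilon>\<close>.  As \<open>0 \<le> r(t) \<le> t\<^sup>2\<close>, the last term integrates to \<open>O(\<epsilon>\<^sup>2)\<close>, so no limit
  has to be taken under the integral.\<close>

lemma rel_entropy_derivative:
  assumes \<eta>: "\<eta> \<in> V" and b: "b \<in> V" and b1: "\<And>x. \<bar>b x\<bar> \<le> 1"
  defines "\<rho> \<equiv> \<lambda>x. \<mu> x * exp (\<eta> x)"
  shows "((\<lambda>\<epsilon>. rel_entropy \<mu> (\<lambda>x. \<rho> x + \<epsilon> * (\<rho> x * b x))) has_real_derivative
            inner_w \<mu> (\<lambda>x. \<eta> x + 1) (\<lambda>x. exp (\<eta> x) * b x)) (at 0)"
    (is "(?F has_real_derivative ?D) (at 0)")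
proof (rule DERIV_at_0_if_quadratic_remainder)
  define r where "r t = (1 + t) * ln (1 + t) - t" for t :: real
  have \<rho>pos: "\<rho> x > 0" for x by (simp add: \<rho>_def mu_pos)
  note ints = L2_mu_mult_integrable[OF V_in_L2 V_in_L2]
  have int\<rho>: "integrable lborel \<rho>"
    using ints[OF V_exp[OF \<eta>] V_const[of 1]] by (simp add: \<rho>_def mult.commute)
  have int\<eta>: "integrable lborel (\<lambda>x. \<eta> x * \<rho> x)"
    using ints[OF \<eta> V_exp[OF \<eta>]] by (simp add: \<rho>_def algebra_simps)
  have intb: "integrable lborel (\<lambda>x. (\<eta> x + 1) * (exp (\<eta> x) * b x) * \<mu> x)"
    by (intro ints V_add V_const V_mult V_exp \<eta> b)
  have [measurable]: "\<rho> \<in> borel_measurable borel" "b \<in> borel_measurable borel"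
    using V_measurable[OF \<eta>] V_measurable[OF b] mu_meas by (auto simp: \<rho>_def)
  have intr: "integrable lborel (\<lambda>x. \<rho> x * r (\<epsilon> * b x))"
    and bound: "\<And>x. 0 \<le> \<rho> x * r (\<epsilon> * b x)" "\<And>x. \<rho> x * r (\<epsilon> * b x) \<le> \<rho> x * \<epsilon>\<^sup>2"
    if "\<bar>\<epsilon>\<bar> < 1" for \<epsilon>
  proof -
    have small: "\<bar>\<epsilon> * b x\<bar> < 1" for x
    proof -
      have "\<bar>\<epsilon>\<bar> * \<bar>b x\<bar> \<le> \<bar>\<epsilon>\<bar> * 1" by (intro mult_left_mono b1) simp
      then show ?thesis using that by (simp add: abs_mult)
    qed
    show lo: "0 \<le> \<rho> x * r (\<epsilon> * b x)" for x
      using entropy_remainder_bounds(1)[OF small[of x]] \<rho>pos[of x] by (simp add: r_def)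
    have "r (\<epsilon> * b x) \<le> \<epsilon>\<^sup>2" for x
    proof -
      have "(b x)\<^sup>2 \<le> 1" using b1[of x] by (simp add: abs_square_le_1)
      then have "\<epsilon>\<^sup>2 * (b x)\<^sup>2 \<le> \<epsilon>\<^sup>2" by (simp add: mult_left_le)
      then show ?thesis
        using entropy_remainder_bounds(2)[OF small[of x]] by (simp add: r_def power_mult_distrib)
    qed
    then show hi: "\<rho> x * r (\<epsilon> * b x) \<le> \<rho> x * \<epsilon>\<^sup>2" for x
      using \<rho>pos[of x] by (intro mult_left_mono) auto
    show "integrable lborel (\<lambda>x. \<rho> x * r (\<epsilon> * b x))"
    proof (rule Bochner_Integration.integrable_bound)
      show "integrable lborel (\<lambda>x. \<rho> x * \<epsilon>\<^sup>2)" using int\<rho> by simp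
      show "(\<lambda>x. \<rho> x * r (\<epsilon> * b x)) \<in> borel_measurable lborel" unfolding r_def by measurable
      show "AE x in lborel. norm (\<rho> x * r (\<epsilon> * b x)) \<le> norm (\<rho> x * \<epsilon>\<^sup>2)"
        unfolding real_norm_def abs_of_nonneg[OF lo]
        by (intro AE_I2 order_trans[OF hi abs_ge_self])
    qed
  qed
  have expand: "?F \<epsilon> = (LINT x|lborel. \<eta> x * \<rho> x) + \<epsilon> * ?D + (LINT x|lborel. \<rho> x * r (\<epsilon> * b x))"
    if "\<bar>\<epsilon>\<bar> < 1" for \<epsilon>
  proof -
    have "ln ((\<rho> x + \<epsilon> * (\<rho> x * b x)) / \<mu> x) * (\<rho> x + \<epsilon> * (\<rho> x * b x))
        = \<eta> x * \<rho> x + \<epsilon> * ((\<eta> x + 1) * (exp (\<eta> x) * b x) * \<mu> x) + \<rho> x * r (\<epsilon> * b x)" for x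
    proof -
      have "\<bar>\<epsilon>\<bar> * \<bar>b x\<bar> \<le> \<bar>\<epsilon>\<bar> * 1" by (intro mult_left_mono b1) simp
      then have "\<bar>\<epsilon> * b x\<bar> < 1" using that by (simp add: abs_mult)
      then have pos: "1 + \<epsilon> * b x > 0" by linarith
      have "(\<rho> x + \<epsilon> * (\<rho> x * b x)) / \<mu> x = exp (\<eta> x) * (1 + \<epsilon> * b x)"
        by (simp add: \<rho>_def mu_nz field_simps)
      then have "ln ((\<rho> x + \<epsilon> * (\<rho> x * b x)) / \<mu> x) = \<eta> x + ln (1 + \<epsilon> * b x)"
        using pos by (simp add: ln_mult)
      then show ?thesis by (simp add: r_def \<rho>_def algebra_simps)
    qed
    then show ?thesis
      using int\<eta> intb intr[OF that] by (simp add: rel_entropy_def inner_w_def)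
  qed
  fix \<epsilon> :: real assume \<epsilon>: "\<bar>\<epsilon>\<bar> < 1"
  have "?F \<epsilon> - ?F 0 - \<epsilon> * ?D = (LINT x|lborel. \<rho> x * r (\<epsilon> * b x))"
    using expand[OF \<epsilon>] expand[of 0] by (simp add: r_def)
  moreover have "0 \<le> (LINT x|lborel. \<rho> x * r (\<epsilon> * b x))"
    by (rule integral_nonneg_AE) (use bound(1)[OF \<epsilon>] in auto)
  moreover have "(LINT x|lborel. \<rho> x * r (\<epsilon> * b x)) \<le> (LINT x|lborel. \<rho> x * \<epsilon>\<^sup>2)"
    using int\<rho> by (intro integral_mono intr[OF \<epsilon>] bound(2)[OF \<epsilon>]) simp
  moreover have "(LINT x|lborel. \<rho> x * \<epsilon>\<^sup>2) = (LINT x|lborel. \<rho> x) * \<epsilon>\<^sup>2" by simp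
  ultimately show "\<bar>?F \<epsilon> - ?F 0 - \<epsilon> * ?D\<bar> \<le> (LINT x|lborel. \<rho> x) * \<epsilon>\<^sup>2" by linarith
qed

text \<open>A functional derivative is only tested on directions dominated by \<open>\<rho>\<close>.  With
  \<open>d = \<xi> - (\<eta> + 1)\<close>, the direction \<open>\<rho> d exp (- d\<^sup>2)\<close> is admissible, as \<open>t exp (- t\<^sup>2)\<close> is bounded
  by \<open>1\<close>, and it pairs with \<open>d\<close> to the integral of a function that is positive wherever \<open>d \<noteq> 0\<close>.\<close>

lemma functional_derivative_rel_entropy_unique:
  assumes \<eta>: "\<eta> \<in> V" and \<xi>: "\<xi> \<in> V"
    and deriv: "functional_derivative (dens \<mu> V) (rel_entropy \<mu>) (\<lambda>x. \<mu> x * exp (\<eta> x)) \<xi>"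
  shows "\<xi> \<doteq> (\<lambda>x. \<eta> x + 1)"
proof -
  define \<rho> where "\<rho> = (\<lambda>x. \<mu> x * exp (\<eta> x))"
  define d where "d = (\<lambda>x. \<xi> x - (\<eta> x + 1))"
  define b where "b = (\<lambda>x. d x * exp (- 1 * (d x * d x)))"
  have \<eta>1: "(\<lambda>x. \<eta> x + 1) \<in> V" by (intro V_add V_const \<eta>)
  have d: "d \<in> V" unfolding d_def by (intro V_diff \<xi> \<eta>1)
  have b: "b \<in> V" unfolding b_def by (intro V_mult V_exp V_scale d)
  have b1: "\<bar>b x\<bar> \<le> 1" for x
  proof -
    have "0 \<le> (\<bar>d x\<bar> - 1)\<^sup>2" by simp
    then have "\<bar>d x\<bar> \<le> 1 + d x * d x"
      using abs_ge_zero[of "d x"] by (simp add: power2_diff) (simp add: power2_eq_square)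
    also have "\<dots> \<le> exp (d x * d x)" by (rule exp_ge_add_one_self)
    finally show ?thesis by (simp add: b_def abs_mult exp_minus field_simps)
  qed
  define k where "k = (\<lambda>x. exp (\<eta> x) * b x)"
  have k: "k \<in> V" unfolding k_def by (intro V_mult V_exp \<eta> b)
  have g: "(\<lambda>x. \<rho> x * b x) = (\<lambda>x. \<mu> x * k x)" by (simp add: \<rho>_def k_def mult.assoc)
  have "\<bar>\<rho> x * b x\<bar> \<le> 1 * \<rho> x" for x
    using mult_left_mono[OF b1[of x], of "\<rho> x"] mu_pos[of x] by (simp add: \<rho>_def abs_mult)
  then have "\<exists>C. \<forall>x. \<bar>\<rho> x * b x\<bar> \<le> C * \<rho> x" by blast
  moreover have "(\<lambda>x. \<rho> x * b x) \<in> dens \<mu> V" unfolding g by (rule mu_mult_in_dens[OF k])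
  ultimately have "((\<lambda>\<epsilon>. rel_entropy \<mu> (\<lambda>x. \<rho> x + \<epsilon> * (\<rho> x * b x))) has_real_derivative
      pairing \<xi> (\<lambda>x. \<rho> x * b x)) (at 0)"
    using bspec[OF deriv[folded \<rho>_def, unfolded functional_derivative_def]] by simp
  moreover have "((\<lambda>\<epsilon>. rel_entropy \<mu> (\<lambda>x. \<rho> x + \<epsilon> * (\<rho> x * b x))) has_real_derivative
      inner_w \<mu> (\<lambda>x. \<eta> x + 1) k) (at 0)"
    unfolding \<rho>_def k_def by (rule rel_entropy_derivative[OF \<eta> b b1])
  ultimately have "pairing \<xi> (\<lambda>x. \<rho> x * b x) = inner_w \<mu> (\<lambda>x. \<eta> x + 1) k"
    by (rule DERIV_unique)
  then have "inner_w \<mu> \<xi> k = inner_w \<mu> (\<lambda>x. \<eta> x + 1) k"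
    unfolding g pairing_commute[of \<xi>] pairing_mu_mult by (simp only: inner_w_commute[of \<mu> k])
  moreover have "d = (\<lambda>x. 1 * \<xi> x + (-1) * (\<eta> x + 1))"
    by (simp add: d_def fun_eq_iff)
  ultimately have "inner_w \<mu> d k = 0"
    using inner_mu_lincomb[OF V_in_L2[OF \<xi>] V_in_L2[OF \<eta>1] V_in_L2[OF k], of 1 "-1"] by simp
  moreover have nonneg: "0 \<le> d x * k x * \<mu> x" for x
  proof -
    have "d x * k x * \<mu> x = (d x)\<^sup>2 * (exp (\<eta> x) * exp (- 1 * (d x * d x)) * \<mu> x)"
      by (simp add: k_def b_def power2_eq_square)
    then show ?thesis by (simp only:) (simp add: mu_nonneg)
  qed
  ultimately have "AE x in lborel. d x * k x * \<mu> x = 0"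
    using integral_nonneg_eq_0_iff_AE[OF L2_mu_mult_integrable[OF V_in_L2[OF d] V_in_L2[OF k]]]
    by (simp add: inner_w_def)
  then show ?thesis unfolding ae_eq_def
    by eventually_elim (auto simp: k_def b_def d_def mu_nz)
qed

end

section \<open>From the quadratic form of the dynamics to the hypocoercive form\<close>

locale quadratic_dynamics = test_space \<mu> V
  for \<mu> :: "('n::finite) func" and V :: "'n func set" +
  fixes L L' W W' :: "'n oper" and M :: "'n func \<Rightarrow> 'n oper"
    and Mroot :: "'n func \<Rightarrow> 'n \<Rightarrow> 'n oper" and A :: "'n \<Rightarrow> 'n oper"
  assumes L_L2: "\<And>f. f \<in> V \<Longrightarrow> L f \<in> L2 \<mu>"
    and L'_dual: "\<And>\<rho>. \<rho> \<in> dens \<mu> V \<Longrightarrow> L' \<rho> \<in> L2_dual \<mu>"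
    and L_adjoint: "formal_adjoint (dens \<mu> V) V L' L"
    and L'_mu: "L' \<mu> \<doteq> (\<lambda>x. 0)"
    and W_dual: "\<And>\<rho>. \<rho> \<in> dens \<mu> V \<Longrightarrow> W \<rho> \<in> L2_dual \<mu>"
    and W'_L2: "\<And>f. f \<in> V \<Longrightarrow> W' f \<in> L2 \<mu>"
    and W_adjoint: "formal_adjoint (dens \<mu> V) V W W'"
    and W'_product: "product_rule V W'"
    and quadratic: "quadratic_pre_GENERIC \<mu> V (rel_entropy \<mu>) L' W M"
    and root: "\<And>\<rho>. \<rho> \<in> pos_dens \<mu> V \<Longrightarrow> square_root_of \<mu> V (M \<rho>) (Mroot \<rho>)"
    and root_form: "\<And>\<rho> \<xi> i. \<rho> \<in> pos_dens \<mu> V \<Longrightarrow> \<xi> \<in> V \<Longrightarrow>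
                       Mroot \<rho> i \<xi> \<doteq> (\<lambda>x. sqrt (2 * \<rho> x) * A i \<xi> x)"
    and A_meas: "\<And>f i. f \<in> V \<Longrightarrow> A i f \<in> borel_measurable borel"
    and A_chain: "\<And>i. chain_rule V (A i)"
begin

lemma L_weak:
  assumes "h \<in> V" "f \<in> V"
  shows "pairing (L' (\<lambda>x. \<mu> x * h x)) f = inner_w \<mu> h (L f)"
  using L_adjoint mu_mult_in_dens[OF \<open>h \<in> V\<close>] \<open>f \<in> V\<close>
  by (simp add: formal_adjoint_def pairing_mu_mult)

lemma W_weak:
  assumes "h \<in> V" "f \<in> V"
  shows "pairing (W (\<lambda>x. \<mu> x * h x)) f = inner_w \<mu> h (W' f)"
  using W_adjoint mu_mult_in_dens[OF \<open>h \<in> V\<close>] \<open>f \<in> V\<close>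
  by (simp add: formal_adjoint_def pairing_mu_mult)

lemma Mroot_pairing:
  assumes \<rho>: "\<rho> \<in> pos_dens \<mu> V" and \<xi>: "\<xi> \<in> V" and f: "f \<in> V"
    and int: "integrable lborel (\<lambda>x. Mroot \<rho> i \<xi> x * Mroot \<rho> i f x)"
  shows "integrable lborel (\<lambda>x. \<rho> x * A i \<xi> x * A i f x)"
    and "pairing (Mroot \<rho> i \<xi>) (Mroot \<rho> i f) = 2 * pairing (\<lambda>x. \<rho> x * A i \<xi> x) (A i f)"
proof -
  have \<rho>meas: "\<rho> \<in> borel_measurable borel" and \<rho>pos: "\<rho> x > 0" for x
    using \<rho> V_measurable by (auto simp: pos_dens_def)
  have ae: "AE x in lborel. Mroot \<rho> i \<xi> x * Mroot \<rho> i f x = 2 * (\<rho> x * A i \<xi> x * A i f x)"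
    using root_form[OF \<rho> \<xi>, of i] root_form[OF \<rho> f, of i] unfolding ae_eq_def
  proof eventually_elim
    case (elim x)
    have "Mroot \<rho> i \<xi> x * Mroot \<rho> i f x
        = (sqrt (2 * \<rho> x) * sqrt (2 * \<rho> x)) * (A i \<xi> x * A i f x)"
      unfolding elim by (simp only: ac_simps)
    also have "sqrt (2 * \<rho> x) * sqrt (2 * \<rho> x) = 2 * \<rho> x"
      using \<rho>pos[of x] by (intro real_sqrt_mult_self[THEN trans]) simp
    finally show ?case by simp
  qed
  have meas: "(\<lambda>x. 2 * (\<rho> x * A i \<xi> x * A i f x)) \<in> borel_measurable lborel"
    using \<rho>meas A_meas[OF \<xi>] A_meas[OF f] by simp
  have "integrable lborel (\<lambda>x. 2 * (\<rho> x * A i \<xi> x * A i f x))"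
    by (rule integrable_cong_AE_imp[OF int meas]) (use ae in auto)
  then show "integrable lborel (\<lambda>x. \<rho> x * A i \<xi> x * A i f x)" by simp
  have "pairing (Mroot \<rho> i \<xi>) (Mroot \<rho> i f) = (LINT x|lborel. 2 * (\<rho> x * A i \<xi> x * A i f x))"
    unfolding pairing_def by (rule integral_cong_AE[OF _ meas ae]) (use int in auto)
  then show "pairing (Mroot \<rho> i \<xi>) (Mroot \<rho> i f) = 2 * pairing (\<lambda>x. \<rho> x * A i \<xi> x) (A i f)"
    by (simp add: pairing_def)
qed

lemma A_integrable:
  assumes \<rho>: "\<rho> \<in> pos_dens \<mu> V" and \<xi>: "\<xi> \<in> V" and f: "f \<in> V"
  shows "integrable lborel (\<lambda>x. \<rho> x * A i \<xi> x * A i f x)"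
proof (rule Mroot_pairing(1)[OF \<rho> \<xi> f])
  show "integrable lborel (\<lambda>x. Mroot \<rho> i \<xi> x * Mroot \<rho> i f x)"
    using root[OF \<rho>] \<xi> f unfolding square_root_of_def formal_adjoint_def by blast
qed

text \<open>\<open>v i\<close> plays the role of \<open>A\<^sub>i' (\<rho> A\<^sub>i \<xi>)\<close>, as half of the \<open>i\<close>-th summand of
  \<open>(M\<^sub>\<rho>\<^sup>1\<^sup>/\<^sup>2)' M\<^sub>\<rho>\<^sup>1\<^sup>/\<^sup>2 \<xi>\<close>.\<close>

lemma M_as_divergence:
  assumes \<rho>: "\<rho> \<in> pos_dens \<mu> V" and \<xi>: "\<xi> \<in> V"
  shows "\<exists>v. (\<forall>i. v i \<in> L2_dual \<mu>) \<and>
    (\<forall>i. \<forall>f\<in>V. pairing (v i) f = pairing (\<lambda>x. \<rho> x * A i \<xi> x) (A i f)) \<and>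
    M \<rho> \<xi> \<doteq> (\<lambda>x. 2 * (\<Sum>i\<in>UNIV. v i x))"
proof -
  obtain R' where adj: "\<And>i. formal_adjoint (Mroot \<rho> i ` V) V (R' i) (Mroot \<rho> i)"
    and R': "\<And>i \<xi>. \<xi> \<in> V \<Longrightarrow> R' i (Mroot \<rho> i \<xi>) \<in> L2_dual \<mu>"
    and M: "\<And>\<xi>. \<xi> \<in> V \<Longrightarrow> M \<rho> \<xi> \<doteq> (\<lambda>x. \<Sum>i\<in>UNIV. R' i (Mroot \<rho> i \<xi>) x)"
    using root[OF \<rho>] unfolding square_root_of_def by blast
  define v where "v i x = R' i (Mroot \<rho> i \<xi>) x / 2" for i x
  have "v i \<in> L2_dual \<mu>" for i
  proof -
    have "(\<lambda>x. (1/2) * (R' i (Mroot \<rho> i \<xi>) x / \<mu> x) + 0 * (R' i (Mroot \<rho> i \<xi>) x / \<mu> x)) \<in> L2 \<mu>"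
      by (rule L2_mu_lincomb; use R'[OF \<xi>] in \<open>simp add: L2_dual_iff\<close>)
    then show ?thesis by (simp add: L2_dual_iff v_def[abs_def])
  qed
  moreover have "pairing (v i) f = pairing (\<lambda>x. \<rho> x * A i \<xi> x) (A i f)" if f: "f \<in> V" for i f
  proof -
    have "integrable lborel (\<lambda>x. Mroot \<rho> i \<xi> x * Mroot \<rho> i f x)"
      and "pairing (R' i (Mroot \<rho> i \<xi>)) f = pairing (Mroot \<rho> i \<xi>) (Mroot \<rho> i f)"
      using adj[of i] \<xi> f by (auto simp: formal_adjoint_def)
    with Mroot_pairing(2)[OF \<rho> \<xi> f] show ?thesis by (simp add: v_def[abs_def] pairing_def)
  qed
  moreover have "M \<rho> \<xi> \<doteq> (\<lambda>x. 2 * (\<Sum>i\<in>UNIV. v i x))"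
    using M[OF \<xi>] by (simp add: v_def sum_divide_distrib[symmetric])
  ultimately show ?thesis by (intro exI[of _ v]) simp
qed

text \<open>Since \<open>\<mu>\<close> is itself a density of the form \<open>\<mu> e\<^sup>\<eta>\<close>, with \<open>\<eta> = 0\<close>, the root at \<open>\<rho> = \<mu>\<close> controls
  the weighted norm of \<open>A\<^sub>i f\<close> and provides the adjoint of \<open>A\<^sub>i\<close> on its range.\<close>

lemma A_L2:
  assumes f: "f \<in> V" shows "A i f \<in> L2 \<mu>"
proof -
  have "(\<lambda>x. \<mu> x * A i f x * A i f x) = (\<lambda>x. (A i f x)\<^sup>2 * \<mu> x)"
    by (simp add: power2_eq_square ac_simps)
  then show ?thesis using A_integrable[OF mu_in_pos_dens f f, of i] A_meas[OF f] by (simp add: L2_def)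
qed

lemma A_adjoint_exists:
  assumes f: "f \<in> V"
  shows "\<exists>v. v \<in> L2 \<mu> \<and> (\<forall>g\<in>V. inner_w \<mu> v g = inner_w \<mu> (A i f) (A i g))"
proof -
  obtain v where v: "\<forall>i. v i \<in> L2_dual \<mu>"
    "\<forall>i. \<forall>g\<in>V. pairing (v i) g = pairing (\<lambda>x. \<mu> x * A i f x) (A i g)"
    using M_as_divergence[OF mu_in_pos_dens f] by blast
  then show ?thesis
    by (intro exI[of _ "\<lambda>x. v i x / \<mu> x"]) (simp add: L2_dual_iff pairing_dual mu_nz)
qed

text \<open>The chain rule involves only one function at a time and by itself does not give additivity.  It
  follows instead from the existence of the adjoint: \<open>\<langle>A\<^sub>i c, A\<^sub>i f\<rangle>\<close> is linear in \<open>f\<close>, so the defect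
  \<open>d = A\<^sub>i (a f + b g) - a A\<^sub>i f - b A\<^sub>i g\<close> is orthogonal to the range of \<open>A\<^sub>i\<close>, hence to itself.\<close>

lemma A_linear: "linear_oper V (A i)"
  unfolding linear_oper_def
proof (intro ballI allI)
  fix f g a b assume f: "f \<in> V" and g: "g \<in> V"
  define k where "k = (\<lambda>x. a * f x + b * g x)"
  define s where "s = (\<lambda>x. a * A i f x + b * A i g x)"
  define d where "d = (\<lambda>x. 1 * A i k x + (-1) * s x)"
  have k: "k \<in> V" unfolding k_def by (rule V_lincomb[OF f g])
  have s: "s \<in> L2 \<mu>" unfolding s_def by (intro L2_mu_lincomb A_L2 f g)
  have d: "d \<in> L2 \<mu>" unfolding d_def by (intro L2_mu_lincomb A_L2 k s)
  have orth: "inner_w \<mu> (A i c) d = 0" if c: "c \<in> V" for c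
  proof -
    obtain v where v: "v \<in> L2 \<mu>" "\<forall>h\<in>V. inner_w \<mu> v h = inner_w \<mu> (A i c) (A i h)"
      using A_adjoint_exists[OF c, of i] by blast
    have "inner_w \<mu> (A i c) (A i k) = inner_w \<mu> v k" using v(2) k by simp
    also have "\<dots> = a * inner_w \<mu> v f + b * inner_w \<mu> v g"
      unfolding k_def by (intro inner_mu_lincomb_right V_in_L2 f g v)
    also have "\<dots> = inner_w \<mu> (A i c) s"
      unfolding s_def v(2)[rule_format, OF f] v(2)[rule_format, OF g] by (intro inner_mu_lincomb_right[symmetric] A_L2 f g c)
    finally show ?thesis
      unfolding d_def by (subst inner_mu_lincomb_right[OF A_L2[OF k] s A_L2[OF c]]) simp
  qed
  have "inner_w \<mu> s d = 0"
    unfolding s_def by (subst inner_mu_lincomb[OF A_L2[OF f] A_L2[OF g] d]) (simp add: orth f g)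
  then have "inner_w \<mu> d d = 0"
    using inner_mu_lincomb[OF A_L2[OF k, of i] s d, of 1 "-1"] orth[OF k] by (simp add: d_def)
  then have "d \<doteq> (\<lambda>x. 0)" by (rule inner_w_self_eq_0[OF mu_pos d])
  then have "A i k \<doteq> s" by (simp add: ae_eq_def d_def)
  then show "A i (\<lambda>x. a * f x + b * g x) \<doteq> (\<lambda>x. a * A i f x + b * A i g x)"
    by (simp only: k_def s_def)
qed

lemma A_lincomb:
  assumes "f \<in> V" "g \<in> V"
  shows "A i (\<lambda>x. a * f x + b * g x) \<doteq> (\<lambda>x. a * A i f x + b * A i g x)"
  using A_linear[of i] assms by (simp add: linear_oper_def)

lemma A_const: "A i (\<lambda>x. c) \<doteq> (\<lambda>x. 0)"
  using A_chain[of i] smooth_const[of c] mu_V by (fastforce simp: chain_rule_def)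

lemma A_exp:
  assumes "\<eta> \<in> V" shows "A i (\<lambda>x. exp (\<eta> x)) \<doteq> (\<lambda>x. exp (\<eta> x) * A i \<eta> x)"
proof -
  have "deriv exp = (exp :: real \<Rightarrow> real)" by (auto intro!: ext DERIV_imp_deriv)
  then show ?thesis
    using A_chain[of i, unfolded chain_rule_def, rule_format, OF assms smooth_exp] by simp
qed

lemma M_pairing:
  assumes \<rho>: "\<rho> \<in> pos_dens \<mu> V" and \<xi>: "\<xi> \<in> V" and f: "f \<in> V"
  shows "pairing (M \<rho> \<xi>) f = 2 * (\<Sum>i\<in>UNIV. pairing (\<lambda>x. \<rho> x * A i \<xi> x) (A i f))"
proof -
  obtain v where v: "\<forall>i. v i \<in> L2_dual \<mu>"
    "\<forall>i. \<forall>g\<in>V. pairing (v i) g = pairing (\<lambda>x. \<rho> x * A i \<xi> x) (A i g)"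
    "M \<rho> \<xi> \<doteq> (\<lambda>x. 2 * (\<Sum>i\<in>UNIV. v i x))"
    using M_as_divergence[OF \<rho> \<xi>] by blast
  have "M \<rho> \<xi> \<in> L2_dual \<mu>" using quadratic \<rho> \<xi> by (simp add: quadratic_pre_GENERIC_def)
  moreover have "(\<lambda>x. 2 * (\<Sum>i\<in>UNIV. v i x)) \<in> borel_measurable borel"
    using L2_dual_measurable[OF v(1)[rule_format]] by (intro borel_measurable_times borel_measurable_sum) auto
  ultimately have "pairing (M \<rho> \<xi>) f = pairing (\<lambda>x. 2 * (\<Sum>i\<in>UNIV. v i x)) f"
    using v(3) V_measurable[OF f] L2_dual_measurable by (intro pairing_cong_AE)
  also have "\<dots> = (LINT x|lborel. 2 * (\<Sum>i\<in>UNIV. v i x * f x))"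
    by (simp add: pairing_def sum_distrib_right mult.assoc)
  also have "\<dots> = 2 * (\<Sum>i\<in>UNIV. pairing (v i) f)"
    using pairing_integrable[OF v(1)[rule_format] V_in_L2[OF f]] by (simp add: pairing_def)
  finally show ?thesis by (simp add: v(2) f)
qed

text \<open>Moving \<open>M\<^sub>\<rho>\<close> to \<open>f\<close> by symmetry allows \<open>\<xi>\<close> to be replaced by the function \<open>\<eta> + 1\<close> that agrees with
  it almost everywhere; \<open>M\<^sub>\<rho>\<close> acts on functions, not on classes modulo null sets.
  The rest is \<open>\<rho> A\<^sub>i \<eta> = \<mu> A\<^sub>i e\<^sup>\<eta>\<close>.\<close>

lemma dissipation_form:
  assumes \<eta>: "\<eta> \<in> V" and \<xi>: "\<xi> \<in> V" and f: "f \<in> V" and \<xi>\<eta>: "\<xi> \<doteq> (\<lambda>x. \<eta> x + 1)"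
  shows "pairing (M (\<lambda>x. \<mu> x * exp (\<eta> x)) (\<lambda>x. 1/2 * \<xi> x)) f
       = (\<Sum>i\<in>UNIV. inner_w \<mu> (A i (\<lambda>x. exp (\<eta> x))) (A i f))"
proof -
  define \<rho> where "\<rho> = (\<lambda>x. \<mu> x * exp (\<eta> x))"
  define \<zeta> where "\<zeta> = (\<lambda>x. (1/2) * \<eta> x + (1/2) * 1)"
  have \<rho>: "\<rho> \<in> pos_dens \<mu> V" unfolding \<rho>_def pos_dens_eq using \<eta> by blast
  have \<zeta>: "\<zeta> \<in> V" unfolding \<zeta>_def by (intro V_lincomb V_const \<eta>)
  have \<xi>2: "(\<lambda>x. 1/2 * \<xi> x) \<in> V" by (rule V_scale[OF \<xi>])
  have Mf: "M \<rho> f \<in> L2_dual \<mu>" and sym: "formal_adjoint V V (M \<rho>) (M \<rho>)"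
    using quadratic \<rho> f by (simp_all add: quadratic_pre_GENERIC_def)
  have swap: "pairing (M \<rho> \<theta>) f = pairing \<theta> (M \<rho> f)" if "\<theta> \<in> V" for \<theta>
    using sym that f by (simp add: formal_adjoint_def)
  have "pairing (M \<rho> (\<lambda>x. 1/2 * \<xi> x)) f = pairing (\<lambda>x. 1/2 * \<xi> x) (M \<rho> f)"
    by (rule swap[OF \<xi>2])
  also have "\<dots> = pairing \<zeta> (M \<rho> f)"
    using \<xi>\<eta> by (intro pairing_cong_AE V_measurable \<xi>2 \<zeta> L2_dual_measurable[OF Mf])
      (auto simp: ae_eq_def \<zeta>_def add_divide_distrib)
  also have "\<dots> = pairing (M \<rho> \<zeta>) f" by (rule swap[OF \<zeta>, symmetric])
  also have "\<dots> = 2 * (\<Sum>i\<in>UNIV. pairing (\<lambda>x. \<rho> x * A i \<zeta> x) (A i f))" by (rule M_pairing[OF \<rho> \<zeta> f])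
  also have "\<dots> = (\<Sum>i\<in>UNIV. inner_w \<mu> (A i (\<lambda>x. exp (\<eta> x))) (A i f))"
    unfolding sum_distrib_left
  proof (rule sum.cong[OF refl])
    fix i
    have "A i \<zeta> \<doteq> (\<lambda>x. (1/2) * A i \<eta> x + (1/2) * A i (\<lambda>x. 1) x)"
      unfolding \<zeta>_def by (rule A_lincomb[OF \<eta> V_const])
    then have ae: "AE x in lborel. 2 * (\<rho> x * A i \<zeta> x * A i f x)
        = A i (\<lambda>x. exp (\<eta> x)) x * A i f x * \<mu> x"
      using A_const[of i 1] A_exp[OF \<eta>, of i] unfolding ae_eq_def
      by eventually_elim (simp add: \<rho>_def)
    have "2 * pairing (\<lambda>x. \<rho> x * A i \<zeta> x) (A i f) = (LINT x|lborel. 2 * (\<rho> x * A i \<zeta> x * A i f x))"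
      by (simp add: pairing_def)
    also have "\<dots> = inner_w \<mu> (A i (\<lambda>x. exp (\<eta> x))) (A i f)"
      unfolding inner_w_def
      by (rule integral_cong_AE[OF _ _ ae])
        (use A_meas[OF \<zeta>] A_meas[OF f] A_meas[OF V_exp[OF \<eta>]] mu_meas V_measurable[OF \<eta>]
          in \<open>auto simp: \<rho>_def\<close>)
    finally show "2 * pairing (\<lambda>x. \<rho> x * A i \<zeta> x) (A i f) = inner_w \<mu> (A i (\<lambda>x. exp (\<eta> x))) (A i f)" .
  qed
  finally show ?thesis by (simp only: \<rho>_def)
qed

lemma weak_equation_exp:
  assumes \<eta>: "\<eta> \<in> V" and f: "f \<in> V"
  shows "pairing (L' (\<lambda>x. \<mu> x * exp (\<eta> x))) f = pairing (W (\<lambda>x. \<mu> x * exp (\<eta> x))) f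
           - (\<Sum>i\<in>UNIV. inner_w \<mu> (A i (\<lambda>x. exp (\<eta> x))) (A i f))"
proof -
  define \<rho> where "\<rho> = (\<lambda>x. \<mu> x * exp (\<eta> x))"
  have \<rho>: "\<rho> \<in> pos_dens \<mu> V" unfolding \<rho>_def pos_dens_eq using \<eta> by blast
  have \<rho>d: "\<rho> \<in> dens \<mu> V" unfolding \<rho>_def by (rule mu_mult_in_dens[OF V_exp[OF \<eta>]])
  obtain \<xi> where \<xi>: "\<xi> \<in> V" and deriv: "functional_derivative (dens \<mu> V) (rel_entropy \<mu>) \<rho> \<xi>"
    and L'\<rho>: "L' \<rho> \<doteq> (\<lambda>x. W \<rho> x - M \<rho> (\<lambda>y. 1/2 * \<xi> y) x)"
    using quadratic \<rho> unfolding quadratic_pre_GENERIC_def by blast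
  have "\<xi> \<doteq> (\<lambda>x. \<eta> x + 1)"
    using functional_derivative_rel_entropy_unique[OF \<eta> \<xi>] deriv by (simp add: \<rho>_def)
  note diss = dissipation_form[OF \<eta> \<xi> f this, folded \<rho>_def]
  have M\<rho>: "M \<rho> (\<lambda>y. 1/2 * \<xi> y) \<in> L2_dual \<mu>"
    using quadratic \<rho> V_scale[OF \<xi>, of "1/2"] by (simp add: quadratic_pre_GENERIC_def)
  have "pairing (L' \<rho>) f = pairing (\<lambda>x. W \<rho> x - M \<rho> (\<lambda>y. 1/2 * \<xi> y) x) f"
    using L2_dual_measurable[OF L'_dual[OF \<rho>d]] L2_dual_measurable[OF W_dual[OF \<rho>d]]
      L2_dual_measurable[OF M\<rho>] V_measurable[OF f] L'\<rho> by (intro pairing_cong_AE) auto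
  also have "\<dots> = pairing (W \<rho>) f - pairing (M \<rho> (\<lambda>y. 1/2 * \<xi> y)) f"
    using pairing_integrable[OF W_dual[OF \<rho>d] V_in_L2[OF f]] pairing_integrable[OF M\<rho> V_in_L2[OF f]]
    by (simp add: pairing_def left_diff_distrib)
  finally show ?thesis unfolding diss by (simp only: \<rho>_def)
qed

text \<open>The case \<open>\<eta> = 0\<close> of the weak equation: there \<open>L' \<mu>\<close> vanishes and so does the dissipation,
  since \<open>A\<^sub>i 1 = 0\<close>.\<close>

lemma W_mu:
  assumes f: "f \<in> V" shows "pairing (W \<mu>) f = 0"
proof -
  have \<mu>d: "\<mu> \<in> dens \<mu> V" using mu_mult_in_dens[OF V_const[of 1]] by simp
  have "pairing (L' \<mu>) f = pairing (\<lambda>x. 0) f"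
    using L2_dual_measurable[OF L'_dual[OF \<mu>d]] V_measurable[OF f] L'_mu
    by (intro pairing_cong_AE) auto
  moreover have "inner_w \<mu> (A i (\<lambda>x. 1)) (A i f) = inner_w \<mu> (\<lambda>x. 0) (A i f)" for i
    using A_meas[OF V_const[of 1], of i] A_meas[OF f, of i] A_const[of i 1]
    by (intro inner_w_cong_AE mu_meas) auto
  ultimately show ?thesis
    using weak_equation_exp[OF V_const[of 0] f] by (simp add: pairing_def inner_w_def)
qed

lemma W'_antisymmetric:
  assumes f: "f \<in> V" and g: "g \<in> V"
  shows "inner_w \<mu> (W' f) g = - inner_w \<mu> f (W' g)"
proof -
  note fg = V_mult[OF f g]
  have "0 = pairing (W (\<lambda>x. \<mu> x * 1)) (\<lambda>x. f x * g x)" using W_mu[OF fg] by simp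
  also have "\<dots> = inner_w \<mu> (W' (\<lambda>x. f x * g x)) (\<lambda>x. 1)"
    unfolding W_weak[OF V_const fg] by (rule inner_w_commute)
  also have "\<dots> = inner_w \<mu> (\<lambda>x. f x * W' g x + g x * W' f x) (\<lambda>x. 1)"
    using W'_product f g V_measurable[OF f] V_measurable[OF g]
      L2_measurable[OF W'_L2[OF f]] L2_measurable[OF W'_L2[OF g]] L2_measurable[OF W'_L2[OF fg]]
    by (intro inner_w_cong_AE mu_meas) (auto simp: product_rule_def)
  also have "\<dots> = (LINT x|lborel. f x * W' g x * \<mu> x + W' f x * g x * \<mu> x)"
    by (simp add: inner_w_def algebra_simps)
  also have "\<dots> = inner_w \<mu> f (W' g) + inner_w \<mu> (W' f) g"
    using L2_mu_mult_integrable[OF V_in_L2[OF f] W'_L2[OF g]]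
      L2_mu_mult_integrable[OF W'_L2[OF f] V_in_L2[OF g]] by (simp add: inner_w_def)
  finally show ?thesis by simp
qed

text \<open>Both sides are linear in \<open>h\<close>, and for \<open>h = e\<^sup>\<eta>\<close> the identity is the weak form of the dynamics.\<close>

lemma weak_equation:
  assumes h: "h \<in> V" and f: "f \<in> V"
  shows "inner_w \<mu> h (L f) = inner_w \<mu> h (W' f) - (\<Sum>i\<in>UNIV. inner_w \<mu> (A i h) (A i f))"
proof -
  obtain \<eta> \<theta> where \<eta>: "\<eta> \<in> V" and \<theta>: "\<theta> \<in> V"
    and h_eq: "h = (\<lambda>x. (1/4) * exp (\<eta> x) + (- 1/4) * exp (\<theta> x))"
    by (rule V_difference_of_exponentials[OF h])
  let ?p = "\<lambda>x. exp (\<eta> x)" and ?q = "\<lambda>x. exp (\<theta> x)"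
  note p = V_exp[OF \<eta>] and q = V_exp[OF \<theta>]
  have eqn: "inner_w \<mu> (\<lambda>x. exp (\<beta> x)) (L f) = inner_w \<mu> (\<lambda>x. exp (\<beta> x)) (W' f)
      - (\<Sum>i\<in>UNIV. inner_w \<mu> (A i (\<lambda>x. exp (\<beta> x))) (A i f))" if "\<beta> \<in> V" for \<beta>
    using weak_equation_exp[OF that f] L_weak[OF V_exp[OF that] f] W_weak[OF V_exp[OF that] f] by simp
  have split: "inner_w \<mu> h k = (1/4) * inner_w \<mu> ?p k + (- 1/4) * inner_w \<mu> ?q k" if "k \<in> L2 \<mu>" for k
    unfolding h_eq by (intro inner_mu_lincomb V_in_L2 p q that)
  have "inner_w \<mu> (A i h) (A i f) = (1/4) * inner_w \<mu> (A i ?p) (A i f) + (- 1/4) * inner_w \<mu> (A i ?q) (A i f)" for i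
  proof -
    have "inner_w \<mu> (A i h) (A i f) = inner_w \<mu> (\<lambda>x. (1/4) * A i ?p x + (- 1/4) * A i ?q x) (A i f)"
    proof (rule inner_w_cong_AE)
      show "A i h \<doteq> (\<lambda>x. (1/4) * A i ?p x + (- 1/4) * A i ?q x)"
        unfolding h_eq by (rule A_lincomb[OF p q])
    qed (use A_meas p q h f mu_meas in auto)
    then show ?thesis by (simp only: inner_mu_lincomb[OF A_L2[OF p] A_L2[OF q] A_L2[OF f]])
  qed
  then have "(\<Sum>i\<in>UNIV. inner_w \<mu> (A i h) (A i f)) = (1/4) * (\<Sum>i\<in>UNIV. inner_w \<mu> (A i ?p) (A i f))
      + (- 1/4) * (\<Sum>i\<in>UNIV. inner_w \<mu> (A i ?q) (A i f))"
    by (simp only: sum.distrib sum_distrib_left)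
  then show ?thesis
    unfolding split[OF L_L2[OF f]] split[OF W'_L2[OF f]] eqn[OF \<eta>] eqn[OF \<theta>] by (simp add: algebra_simps)
qed

text \<open>The adjoints are given by duality.  A choice is made because the defining property fixes
  their values only up to null sets; outside the ranges on which they are considered they are
  arbitrary.\<close>

definition A_star :: "'n \<Rightarrow> 'n oper" where
  "A_star i u = (SOME v. v \<in> L2 \<mu> \<and> (\<forall>g\<in>V. inner_w \<mu> v g = inner_w \<mu> u (A i g)))"

definition A_prime :: "'n \<Rightarrow> 'n oper" where
  "A_prime i u = (SOME v. v \<in> L2_dual \<mu> \<and> (\<forall>g\<in>V. pairing v g = pairing u (A i g)))"

lemma A_star:
  assumes "f \<in> V"
  shows "A_star i (A i f) \<in> L2 \<mu>"
    and "g \<in> V \<Longrightarrow> inner_w \<mu> (A_star i (A i f)) g = inner_w \<mu> (A i f) (A i g)"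
proof -
  have "\<exists>v. v \<in> L2 \<mu> \<and> (\<forall>g\<in>V. inner_w \<mu> v g = inner_w \<mu> (A i f) (A i g))"
    by (rule A_adjoint_exists[OF assms])
  from someI_ex[OF this, folded A_star_def]
  show "A_star i (A i f) \<in> L2 \<mu>"
    "g \<in> V \<Longrightarrow> inner_w \<mu> (A_star i (A i f)) g = inner_w \<mu> (A i f) (A i g)" by auto
qed

lemma A_prime:
  assumes "\<rho> \<in> pos_dens \<mu> V" "\<xi> \<in> V"
  shows "A_prime i (\<lambda>x. \<rho> x * A i \<xi> x) \<in> L2_dual \<mu>"
    and "g \<in> V \<Longrightarrow> pairing (A_prime i (\<lambda>x. \<rho> x * A i \<xi> x)) g = pairing (\<lambda>x. \<rho> x * A i \<xi> x) (A i g)"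
proof -
  have "\<exists>v. v \<in> L2_dual \<mu> \<and> (\<forall>g\<in>V. pairing v g = pairing (\<lambda>x. \<rho> x * A i \<xi> x) (A i g))"
    using M_as_divergence[OF assms] by blast
  from someI_ex[OF this, folded A_prime_def]
  show "A_prime i (\<lambda>x. \<rho> x * A i \<xi> x) \<in> L2_dual \<mu>"
    "g \<in> V \<Longrightarrow> pairing (A_prime i (\<lambda>x. \<rho> x * A i \<xi> x)) g = pairing (\<lambda>x. \<rho> x * A i \<xi> x) (A i g)"
    by auto
qed

lemma A_star_sum_L2:
  "f \<in> V \<Longrightarrow> (\<lambda>x. \<Sum>i\<in>I. A_star i (A i f) x) \<in> L2 \<mu>"
proof (induction I rule: infinite_finite_induct)
  case (insert i I)
  then show ?case using L2_mu_lincomb[of "A_star i (A i f)" "\<lambda>x. \<Sum>i\<in>I. A_star i (A i f) x" 1 1]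
    by (simp add: A_star)
qed (simp_all add: L2_def)

lemma A_star_sum_inner:
  assumes f: "f \<in> V" and h: "h \<in> V"
  shows "inner_w \<mu> (\<lambda>x. \<Sum>i\<in>UNIV. A_star i (A i f) x) h = (\<Sum>i\<in>UNIV. inner_w \<mu> (A i f) (A i h))"
proof -
  have "inner_w \<mu> (\<lambda>x. \<Sum>i\<in>UNIV. A_star i (A i f) x) h
      = (LINT x|lborel. (\<Sum>i\<in>UNIV. A_star i (A i f) x * h x * \<mu> x))"
    by (simp add: inner_w_def sum_distrib_right)
  also have "\<dots> = (\<Sum>i\<in>UNIV. inner_w \<mu> (A_star i (A i f)) h)"
    using L2_mu_mult_integrable[OF A_star(1)[OF f] V_in_L2[OF h]] by (simp add: inner_w_def)
  finally show ?thesis by (simp add: A_star(2) f h)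
qed

lemma L_decomposition:
  assumes f: "f \<in> V"
  shows "L f \<doteq> (\<lambda>x. W' f x - (\<Sum>i\<in>UNIV. A_star i (A i f) x))"
proof -
  let ?S = "\<lambda>x. \<Sum>i\<in>UNIV. A_star i (A i f) x"
  have "L f \<doteq> (\<lambda>x. 1 * W' f x + (-1) * ?S x)"
  proof (rule total_eqI)
    show "(\<lambda>x. 1 * W' f x + (-1) * ?S x) \<in> L2 \<mu>"
      by (intro L2_mu_lincomb W'_L2 A_star_sum_L2 f)
    fix h assume h: "h \<in> V"
    have "inner_w \<mu> (\<lambda>x. 1 * W' f x + (-1) * ?S x) h = inner_w \<mu> (W' f) h - inner_w \<mu> ?S h"
      by (subst inner_mu_lincomb[OF W'_L2[OF f] A_star_sum_L2[OF f] V_in_L2[OF h]]) simp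
    then show "inner_w \<mu> (L f) h = inner_w \<mu> (\<lambda>x. 1 * W' f x + (-1) * ?S x) h"
      using weak_equation[OF h f]
      by (simp add: A_star_sum_inner[OF f h] inner_w_commute[of \<mu> h] inner_w_commute[of \<mu> "A _ h"])
  qed (rule L_L2[OF f])
  then show ?thesis by simp
qed

text \<open>The signs of \<open>W'\<close> and \<open>A\<^sup>*A\<close> relative to those in \<open>L\<close> come from moving the weak equation to
  the first argument: \<open>W'\<close> is antisymmetric and the form \<open>\<Sum>\<^sub>i \<langle>A\<^sub>i h, A\<^sub>i f\<rangle>\<close> is symmetric.\<close>

lemma L'_decomposition:
  assumes h: "h \<in> V"
  shows "L' (\<lambda>x. \<mu> x * h x) \<doteq> (\<lambda>x. \<mu> x * - (W' h x + (\<Sum>i\<in>UNIV. A_star i (A i h) x)))"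
proof -
  let ?S = "\<lambda>x. \<Sum>i\<in>UNIV. A_star i (A i h) x"
  define k where "k = (\<lambda>x. (-1) * W' h x + (-1) * ?S x)"
  have k: "k \<in> L2 \<mu>" unfolding k_def by (intro L2_mu_lincomb W'_L2 A_star_sum_L2 h)
  have "L' (\<lambda>x. \<mu> x * h x) \<doteq> (\<lambda>x. \<mu> x * k x)"
  proof (rule dual_eqI)
    show "L' (\<lambda>x. \<mu> x * h x) \<in> L2_dual \<mu>" by (rule L'_dual[OF mu_mult_in_dens[OF h]])
    show "(\<lambda>x. \<mu> x * k x) \<in> L2_dual \<mu>" using k by (simp add: L2_dual_mu_mult)
    fix f assume f: "f \<in> V"
    have "inner_w \<mu> k f = - inner_w \<mu> (W' h) f - inner_w \<mu> ?S f"
      unfolding k_def by (subst inner_mu_lincomb[OF W'_L2[OF h] A_star_sum_L2[OF h] V_in_L2[OF f]]) simp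
    then show "pairing (L' (\<lambda>x. \<mu> x * h x)) f = pairing (\<lambda>x. \<mu> x * k x) f"
      unfolding L_weak[OF h f] pairing_mu_mult
      using weak_equation[OF h f] W'_antisymmetric[OF h f] by (simp add: A_star_sum_inner[OF h f])
  qed
  then show ?thesis by (simp add: k_def)
qed

lemma M_decomposition:
  assumes \<rho>: "\<rho> \<in> pos_dens \<mu> V" and \<xi>: "\<xi> \<in> V"
  shows "M \<rho> \<xi> \<doteq> (\<lambda>x. 2 * (\<Sum>i\<in>UNIV. A_prime i (\<lambda>y. \<rho> y * A i \<xi> y) x))"
proof -
  obtain v where v: "\<forall>i. v i \<in> L2_dual \<mu>"
    "\<forall>i. \<forall>f\<in>V. pairing (v i) f = pairing (\<lambda>x. \<rho> x * A i \<xi> x) (A i f)"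
    "M \<rho> \<xi> \<doteq> (\<lambda>x. 2 * (\<Sum>i\<in>UNIV. v i x))"
    using M_as_divergence[OF \<rho> \<xi>] by blast
  have "v i \<doteq> A_prime i (\<lambda>y. \<rho> y * A i \<xi> y)" for i
    by (rule dual_eqI) (simp_all add: v A_prime[OF \<rho> \<xi>])
  then have "AE x in lborel. \<forall>i\<in>UNIV. v i x = A_prime i (\<lambda>y. \<rho> y * A i \<xi> y) x"
    by (simp add: ae_eq_def AE_all_countable)
  with v(3) show ?thesis unfolding ae_eq_def
    by eventually_elim simp
qed

lemma A_prime_formal_adjoint:
  "formal_adjoint {\<lambda>x. \<rho> x * A i \<xi> x | \<rho> \<xi>. \<rho> \<in> pos_dens \<mu> V \<and> \<xi> \<in> V} V (A_prime i) (A i)"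
  unfolding formal_adjoint_def
proof (intro ballI)
  fix u f assume "u \<in> {\<lambda>x. \<rho> x * A i \<xi> x | \<rho> \<xi>. \<rho> \<in> pos_dens \<mu> V \<and> \<xi> \<in> V}" and f: "f \<in> V"
  then obtain \<rho> \<xi> where u: "u = (\<lambda>x. \<rho> x * A i \<xi> x)" and \<rho>: "\<rho> \<in> pos_dens \<mu> V" and \<xi>: "\<xi> \<in> V"
    by blast
  have "integrable lborel (\<lambda>x. u x * A i f x)"
    unfolding u by (rule A_integrable[OF \<rho> \<xi> f])
  moreover have "integrable lborel (\<lambda>x. A_prime i u x * f x)"
    unfolding u by (rule pairing_integrable[OF A_prime(1)[OF \<rho> \<xi>] V_in_L2[OF f]])
  ultimately show "integrable lborel (\<lambda>x. A_prime i u x * f x) \<and>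
      integrable lborel (\<lambda>x. u x * A i f x) \<and> pairing (A_prime i u) f = pairing u (A i f)"
    using A_prime(2)[OF \<rho> \<xi> f, of i] by (simp add: u)
qed

lemma hypocoercive_form:
  assumes "chain_rule V W'"
  shows "linear_hypocoercive_form \<mu> V L W' A A_star"
  unfolding linear_hypocoercive_form_def
proof (intro conjI ballI allI)
  show "linear_oper V L" by (rule adjoint_imp_linear[OF L_adjoint L_L2])
  show "linear_oper V W'" by (rule adjoint_imp_linear[OF W_adjoint W'_L2])
  show "L2_adjoint \<mu> V W' f (\<lambda>x. - W' f x)" if f: "f \<in> V" for f
  proof -
    have "inner_w \<mu> (\<lambda>x. - W' f x) g = inner_w \<mu> f (W' g)" if "g \<in> V" for g
      using W'_antisymmetric[OF f that] by (simp add: inner_w_def)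
    moreover have "(\<lambda>x. - W' f x) \<in> L2 \<mu>" using W'_L2[OF f] by (simp add: L2_def)
    ultimately show ?thesis by (simp add: L2_adjoint_def V_in_L2 f)
  qed
  show "L2_adjoint \<mu> V (A i) (A i f) (A_star i (A i f))" if "f \<in> V" for i f
    using that by (simp add: L2_adjoint_def A_L2 A_star)
qed (fact assms W'_product W'_L2 A_L2 A_linear A_chain L_decomposition)+

lemma evolves_ratio:
  assumes \<rho>: "\<And>t. t \<ge> 0 \<Longrightarrow> \<rho> t \<in> dens \<mu> V" and ev: "evolves L' \<rho>"
  shows "evolves (\<lambda>h x. - (W' h x + (\<Sum>i\<in>UNIV. A_star i (A i h) x))) (\<lambda>t x. \<rho> t x / \<mu> x)"
  unfolding evolves_def
proof (intro allI impI)
  fix t :: real assume t: "t \<ge> 0"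
  define h where "h = (\<lambda>x. \<rho> t x / \<mu> x)"
  have h: "h \<in> V" and \<rho>h: "\<rho> t = (\<lambda>x. \<mu> x * h x)"
    using \<rho>[OF t] by (simp_all add: h_def dens_def mu_nz)
  have "AE x in lborel. ((\<lambda>s. \<rho> s x) has_real_derivative L' (\<rho> t) x) (at t within {0..})"
    using ev t by (simp add: evolves_def)
  with L'_decomposition[OF h, folded \<rho>h]
  have "AE x in lborel. ((\<lambda>s. \<rho> s x / \<mu> x) has_real_derivative
      - (W' h x + (\<Sum>i\<in>UNIV. A_star i (A i h) x))) (at t within {0..})"
    unfolding ae_eq_def
  proof eventually_elim
    case (elim x)
    from DERIV_cdivide[OF elim(2), of "\<mu> x"] show ?case
      by (simp add: elim(1) mu_nz)
  qed
  then show "AE x in lborel. ((\<lambda>s. \<rho> s x / \<mu> x) has_real_derivative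
      - (W' (\<lambda>x. \<rho> t x / \<mu> x) x + (\<Sum>i\<in>UNIV. A_star i (A i (\<lambda>x. \<rho> t x / \<mu> x)) x))) (at t within {0..})"
    by (simp add: h_def)
qed

end

text \<open>Orthogonality to \<open>V\<close> is transported through the two density hypotheses, first to the
  common domain of the generator and its adjoint and then to all of \<open>L\<^sup>2\<close>.\<close>

lemma kolmogorov_setting_imp_test_space:
  assumes "kolmogorov_setting \<Omega> X P \<mu> V L L'"
  shows "test_space \<mu> V"
proof -
  let ?D = "generator_dom \<mu> P \<inter> generator_adjoint_dom \<mu> P"
  have meas: "\<mu> \<in> borel_measurable borel" and pos: "\<And>x. \<mu> x > 0"
    and alg: "smooth_algebra V" "\<mu> \<in> V"
    and dense: "dense_in \<mu> V ?D" "dense_in \<mu> ?D (L2 \<mu>)"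
    using assms by (auto simp: kolmogorov_setting_def)
  have D: "?D \<subseteq> L2 \<mu>" using dense(2) by (simp add: dense_in_def)
  show ?thesis
  proof
    show "V \<subseteq> L2 \<mu>" using dense(1) D by (auto simp: dense_in_def)
    fix u assume u: "u \<in> L2 \<mu>" and orth: "\<And>f. f \<in> V \<Longrightarrow> inner_w \<mu> u f = 0"
    note step = orthogonal_to_dense[OF meas less_imp_le[OF pos]]
    have "inner_w \<mu> u f = 0" if "f \<in> ?D" for f
      by (rule step[OF dense(1) D u orth that])
    then have "inner_w \<mu> u u = 0" using step[OF dense(2) order_refl u _ u] by blast
    then show "u \<doteq> (\<lambda>x. 0)" by (rule inner_w_self_eq_0[OF pos u])
  qed (use meas pos alg in auto)
qed

theorem mainTheorem2:
  fixes \<Omega> :: "'w measure"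
    and X :: "real \<Rightarrow> 'w \<Rightarrow> real ^ 'n::finite"
    and P :: "real \<Rightarrow> real ^ 'n \<Rightarrow> (real ^ 'n) measure"
    and \<mu> :: "'n func" and V :: "'n func set"
    and L L' W W' :: "'n oper"
    and M :: "'n func \<Rightarrow> 'n oper"
    and Mroot :: "'n func \<Rightarrow> 'n \<Rightarrow> 'n oper"
    and A :: "'n \<Rightarrow> 'n oper"
  assumes setting: "kolmogorov_setting \<Omega> X P \<mu> V L L'"
    and W_maps: "\<And>\<rho>. \<rho> \<in> dens \<mu> V \<Longrightarrow> W \<rho> \<in> L2_dual \<mu>"
    and W'_maps: "\<And>f. f \<in> V \<Longrightarrow> W' f \<in> L2 \<mu>"
    and W_adjoint: "formal_adjoint (dens \<mu> V) V W W'"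
    and W_rules: "chain_rule V W" "product_rule V W"
    and W'_rules: "chain_rule V W'" "product_rule V W'"
    and pre_GENERIC: "quadratic_pre_GENERIC \<mu> V (rel_entropy \<mu>) L' W M"
    and root: "\<And>\<rho>. \<rho> \<in> pos_dens \<mu> V \<Longrightarrow> square_root_of \<mu> V (M \<rho>) (Mroot \<rho>)"
    and root_form: "\<And>\<rho> \<xi> i. \<rho> \<in> pos_dens \<mu> V \<Longrightarrow> \<xi> \<in> V \<Longrightarrow>
                       Mroot \<rho> i \<xi> \<doteq> (\<lambda>x. sqrt (2 * \<rho> x) * A i \<xi> x)"
    and A_meas: "\<And>f i. f \<in> V \<Longrightarrow> A i f \<in> borel_measurable borel"
    and A_chain: "\<And>i. chain_rule V (A i)"
  shows "\<exists>A' As.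
      linear_hypocoercive_form \<mu> V L W' A As \<and>
      (\<forall>i. formal_adjoint {\<lambda>x. \<rho> x * A i \<xi> x | \<rho> \<xi>. \<rho> \<in> pos_dens \<mu> V \<and> \<xi> \<in> V} V (A' i) (A i)) \<and>
      (\<forall>\<rho>\<in>pos_dens \<mu> V. \<forall>\<xi>\<in>V.
         (\<forall>i. A' i (\<lambda>x. \<rho> x * A i \<xi> x) \<in> L2_dual \<mu>) \<and>
         M \<rho> \<xi> \<doteq> (\<lambda>x. 2 * (\<Sum>i\<in>UNIV. A' i (\<lambda>y. \<rho> y * A i \<xi> y) x))) \<and>
      (\<forall>\<rho>. (\<forall>t\<ge>0. \<rho> t \<in> dens \<mu> V) \<longrightarrow> evolves L' \<rho> \<longrightarrow>
         evolves (\<lambda>h x. - (W' h x + (\<Sum>i\<in>UNIV. As i (A i h) x))) (\<lambda>t x. \<rho> t x / \<mu> x))"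
proof -
  interpret test_space \<mu> V by (rule kolmogorov_setting_imp_test_space[OF setting])
  interpret quadratic_dynamics \<mu> V L L' W W' M Mroot A
  proof
    show "L f \<in> L2 \<mu>" if "f \<in> V" for f
      using setting that by (simp add: kolmogorov_setting_def generator_def)
    show "L' \<rho> \<in> L2_dual \<mu>" if "\<rho> \<in> dens \<mu> V" for \<rho>
      using setting that by (simp add: kolmogorov_setting_def)
    show "formal_adjoint (dens \<mu> V) V L' L" "L' \<mu> \<doteq> (\<lambda>x. 0)"
      using setting by (simp_all add: kolmogorov_setting_def)
  qed (fact W_maps W'_maps W_adjoint W'_rules pre_GENERIC root root_form A_meas A_chain)+
  show ?thesis
  proof (intro exI conjI ballI allI impI)
    show "linear_hypocoercive_form \<mu> V L W' A A_star"
      by (rule hypocoercive_form[OF W'_rules(1)])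
    show "evolves (\<lambda>h x. - (W' h x + (\<Sum>i\<in>UNIV. A_star i (A i h) x))) (\<lambda>t x. \<rho> t x / \<mu> x)"
      if "\<forall>t\<ge>0. \<rho> t \<in> dens \<mu> V" "evolves L' \<rho>" for \<rho>
      using that by (intro evolves_ratio) simp_all
  qed (fact A_prime_formal_adjoint | rule A_prime(1) M_decomposition; assumption)+
qed

end
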